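(* Let $0<\beta<1$ and $c>0$, and let $n$ be sufficiently large depending only on $\beta,c$. Let $A$ be a real symmetric $n\times n$ matrix such that $\|A\|_{\mathrm{op}}\le3$ and such that $A\in\Omega_{\beta,c}$. Then there are finite constants $C_{\beta,c}$, $L\le C_{\beta,c}$, $L_{\mathrm{drift}}$, $L_\omega$, independent of $n$ and $A$, such that: (d3) For every $m\in\mathcal S_A(c)$, $\|f(m)-m\|_2^2\le C_{\beta,c}^2$. (d4)(a) For all $m,w\in\mathcal S_A(c)$, $\|\hat Q(m)-\hat Q(w)\|_F\le L\|m-w\|_2$. (d4)(b) For all $m,w\in\mathcal S_A(c)$, $\big\|\hat Q(m)(m-f(m))-\hat Q(w)(w-f(w))\big\|_2\le L_{\mathrm{drift}}\|m-w\|_2$. (d5) With $\omega(m):=\frac12\big(\mathrm{Tr}[\hat Q(m)]+\|m\|_2^2\big)$, one has $|\omega(m)-\omega(w)|\le L_\omega\|m-w\|_2$ for all $m,w\in\mathcal S_A(c)$.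
   Context: Notation: $\mathcal D_n(K)$ is the set of diagonal $n\times n$ matrices with entries in $K$; $E_{\mathcal D_n}$ is the projection of a matrix onto its diagonal; $\mathrm{tr}_n=\frac1n\mathrm{Tr}$; $\|X\|_{L^2}=(\mathrm{tr}_n X^*X)^{1/2}$; $\|\cdot\|_F$ is the unnormalized Frobenius norm. For $m\in(-1,1)^n$ let $D(m)=\mathrm{diag}\big(\frac{1}{1-m_i^2}\big)$ and $$\nabla^2\mathcal F_{\mathrm{TAP}}(m)=\beta^2\Big(1-\frac{\|m\|_2^2}n\Big)I_n-\beta A+D(m)-\frac{2\beta^2}n mm^{\mathsf T},\qquad \hat Q(m)=\big(\nabla^2\mathcal F_{\mathrm{TAP}}(m)\big)^{-1},$$ $$\mathcal S_A(c)=\{m\in(-1,1)^n:\ c\,D(m)\prec\nabla^2\mathcal F_{\mathrm{TAP}}(m)\},$$ $$f(m)=\Big(E_{\mathcal D_n}[D(m)\hat Q(m)^2D(m)]-\beta^2\mathrm{tr}_n(\hat Q(m)^2)I_n-\frac{2\beta^2}n\hat Q(m)^2\Big)m .$$ Set $$\gamma_Y=\min\Big\{\frac{(1-\beta)^4}{4(1+2\beta^2)^2},\ \Big(1+\frac{1+3\beta}c\Big)^{-2}\Big\},\qquad \mathcal S_D=\big\{D\in\mathcal D_n([1,\infty)):\ \beta^2\mathrm{tr}_n(D^{-1})I_n-\beta A+D\succeq cI_n\big\}.$$ With $C$ a fixed universal constant, $\Omega_{\beta,c}$ is the set of symmetric $A$ such that for all $D\in\mathcal S_D$, $$\Big\|E_{\mathcal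 D_n}\big[D(\beta^2\mathrm{tr}_n(D^{-1})I_n-\beta A+D)^{-2}D\big]-\frac{I_n}{1-\beta^2\mathrm{tr}_n(D^{-2})}\Big\|_{L^2}\le\frac{C\beta}{\gamma_Y^2\sqrt n}.$$ *)

theory Defs
  imports Complex_Main "Jordan_Normal_Form.Gauss_Jordan_Elimination"
begin

text \<open>
  The dimension \<open>n\<close> has to be quantified inside the statement (the constants do not depend
  on it), so matrices and vectors are the carrier-based ones of \<open>Jordan_Normal_Form\<close>.
\<close>

definition vnorm :: "real vec \<Rightarrow> real" where
  "vnorm v = sqrt (v \<bullet> v)"

definition mtrace :: "real mat \<Rightarrow> real" where
  "mtrace X = (\<Sum>i<dim_row X. X $$ (i, i))"

definition ntrace :: "real mat \<Rightarrow> real" where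
  "ntrace X = mtrace X / real (dim_row X)"

definition norm_F :: "real mat \<Rightarrow> real" where
  "norm_F X = sqrt (mtrace (transpose_mat X * X))"

definition norm_L2 :: "real mat \<Rightarrow> real" where
  "norm_L2 X = sqrt (ntrace (transpose_mat X * X))"

definition norm_op :: "real mat \<Rightarrow> real" where
  "norm_op X = (SUP v\<in>{v \<in> carrier_vec (dim_col X). vnorm v \<le> 1}. vnorm (X *\<^sub>v v))"

text \<open>The value of \<open>minv\<close> is unspecified on singular matrices.\<close>

definition minv :: "real mat \<Rightarrow> real mat" where
  "minv X = the (mat_inverse X)"

definition outer :: "real vec \<Rightarrow> real vec \<Rightarrow> real mat" where
  "outer u v = mat (dim_vec u) (dim_vec v) (\<lambda>(i, j). u $ i * v $ j)"

definition diag_proj :: "real mat \<Rightarrow> real mat" where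
  "diag_proj X = mat (dim_row X) (dim_col X) (\<lambda>(i, j). if i = j then X $$ (i, j) else 0)"

definition pos_semidef :: "nat \<Rightarrow> real mat \<Rightarrow> bool" where
  "pos_semidef n X \<longleftrightarrow> X \<in> carrier_mat n n \<and> transpose_mat X = X \<and>
     (\<forall>v\<in>carrier_vec n. 0 \<le> v \<bullet> (X *\<^sub>v v))"

definition pos_def :: "nat \<Rightarrow> real mat \<Rightarrow> bool" where
  "pos_def n X \<longleftrightarrow> X \<in> carrier_mat n n \<and> transpose_mat X = X \<and>
     (\<forall>v\<in>carrier_vec n. v \<noteq> 0\<^sub>v n \<longrightarrow> 0 < v \<bullet> (X *\<^sub>v v))"

definition loewner_le :: "nat \<Rightarrow> real mat \<Rightarrow> real mat \<Rightarrow> bool" where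
  "loewner_le n X Y \<longleftrightarrow> pos_semidef n (Y - X)"

definition loewner_less :: "nat \<Rightarrow> real mat \<Rightarrow> real mat \<Rightarrow> bool" where
  "loewner_less n X Y \<longleftrightarrow> pos_def n (Y - X)"

definition diag_mats :: "nat \<Rightarrow> real set \<Rightarrow> real mat set" where
  "diag_mats n K = {D \<in> carrier_mat n n. diagonal_mat D \<and> (\<forall>i<n. D $$ (i, i) \<in> K)}"

definition open_cube :: "nat \<Rightarrow> real vec set" where
  "open_cube n = {m \<in> carrier_vec n. \<forall>i<n. m $ i \<in> {-1<..<1}}"

definition D_mat :: "real vec \<Rightarrow> real mat" where
  "D_mat m = mat_diag (dim_vec m) (\<lambda>i. 1 / (1 - (m $ i)\<^sup>2))"

definition hess_TAP :: "real \<Rightarrow> real mat \<Rightarrow> real vec \<Rightarrow> real mat" where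
  "hess_TAP \<beta> A m = (let n = dim_vec m in
     (\<beta>\<^sup>2 * (1 - (vnorm m)\<^sup>2 / real n)) \<cdot>\<^sub>m 1\<^sub>m n - \<beta> \<cdot>\<^sub>m A + D_mat m
       - (2 * \<beta>\<^sup>2 / real n) \<cdot>\<^sub>m outer m m)"

definition Q_hat :: "real \<Rightarrow> real mat \<Rightarrow> real vec \<Rightarrow> real mat" where
  "Q_hat \<beta> A m = minv (hess_TAP \<beta> A m)"

definition S_dom :: "real \<Rightarrow> nat \<Rightarrow> real mat \<Rightarrow> real \<Rightarrow> real vec set" where
  "S_dom \<beta> n A c = {m \<in> open_cube n. loewner_less n (c \<cdot>\<^sub>m D_mat m) (hess_TAP \<beta> A m)}"

definition f_drift :: "real \<Rightarrow> real mat \<Rightarrow> real vec \<Rightarrow> real vec" where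
  "f_drift \<beta> A m = (let n = dim_vec m; Q = Q_hat \<beta> A m; D = D_mat m in
     (diag_proj (D * Q ^\<^sub>m 2 * D) - (\<beta>\<^sup>2 * ntrace (Q ^\<^sub>m 2)) \<cdot>\<^sub>m 1\<^sub>m n
       - (2 * \<beta>\<^sup>2 / real n) \<cdot>\<^sub>m Q ^\<^sub>m 2) *\<^sub>v m)"

definition gamma_Y :: "real \<Rightarrow> real \<Rightarrow> real" where
  "gamma_Y \<beta> c = min ((1 - \<beta>) ^ 4 / (4 * (1 + 2 * \<beta>\<^sup>2)\<^sup>2)) (inverse ((1 + (1 + 3 * \<beta>) / c)\<^sup>2))"

definition Y_mat :: "real \<Rightarrow> real mat \<Rightarrow> real mat \<Rightarrow> real mat" where
  "Y_mat \<beta> A D = (\<beta>\<^sup>2 * ntrace (minv D)) \<cdot>\<^sub>m 1\<^sub>m (dim_row D) - \<beta> \<cdot>\<^sub>m A + D"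

definition S_D :: "real \<Rightarrow> real \<Rightarrow> nat \<Rightarrow> real mat \<Rightarrow> real mat set" where
  "S_D \<beta> c n A = {D \<in> diag_mats n {1..}. loewner_le n (c \<cdot>\<^sub>m 1\<^sub>m n) (Y_mat \<beta> A D)}"

definition Omega :: "real \<Rightarrow> real \<Rightarrow> real \<Rightarrow> nat \<Rightarrow> real mat set" where
  "Omega C \<beta> c n = {A \<in> carrier_mat n n. transpose_mat A = A \<and>
     (\<forall>D\<in>S_D \<beta> c n A.
        norm_L2 (diag_proj (D * minv (Y_mat \<beta> A D) ^\<^sub>m 2 * D)
                  - (1 / (1 - \<beta>\<^sup>2 * ntrace (minv D ^\<^sub>m 2))) \<cdot>\<^sub>m 1\<^sub>m n)
          \<le> C * \<beta> / ((gamma_Y \<beta> c)\<^sup>2 * sqrt (real n)))}"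

definition omega :: "real \<Rightarrow> real mat \<Rightarrow> real vec \<Rightarrow> real" where
  "omega \<beta> A m = (mtrace (Q_hat \<beta> A m) + (vnorm m)\<^sup>2) / 2"

end

theory Submission
  imports Defs "HOL-Analysis.L2_Norm" "Jordan_Normal_Form.Determinant"
begin

text \<open>
  Write \<open>x\<^sub>i = 1 - m\<^sub>i\<^sup>2\<close>, so that \<open>D(m) = diag(1/x\<^sub>i)\<close> and the Hessian has the form
  \<open>G + D\<close>, where \<open>G\<close> is bounded in operator norm independently of \<open>n\<close>, while \<open>D \<ge> I\<close> may be
  arbitrarily large. Three ideas carry the proof.

  \<^emph>\<open>The singular part cancels.\<close> On \<open>S\<^sub>A(c)\<close> the Hessian is at least \<open>c I\<close>, hence \<open>Q\<close> is bounded by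
  \<open>1/c\<close>, and \<open>D Q = I - G Q\<close> is bounded as well. Since \<open>1/y - 1/x = (x - y)/(x y)\<close>, the resolvent
  identity reads
  \<open>Q - Q' = Q (G' - G) Q' + (Q D) diag(x - x') (D' Q')\<close>, and every factor is controlled. So \<open>Q\<close>, \<open>D Q\<close>
  and \<open>D Q\<^sup>2 D\<close> are Lipschitz in Frobenius norm with constants that do not see \<open>n\<close> or the size of \<open>D\<close>
  (locale \<open>resolvent_pair\<close>). The identity compares any two points directly, although \<open>S\<^sub>A(c)\<close> need
  not be convex.

  \<^emph>\<open>The drift is almost the identity.\<close> Let \<open>Y\<close> be the Hessian without its rank-one term, \<open>R = Y\<^sup>-\<^sup>1\<close>,
  and let the defect of \<open>R\<close> be \<open>E[D R\<^sup>2 D] - (1 + \<beta>\<^sup>2 tr\<^sub>n(R\<^sup>2)) I\<close>. Membership in \<open>\<Omega>\<close> says that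
  \<open>E[D R\<^sup>2 D]\<close> is close to the scalar matrix \<open>s I\<close>, \<open>s = 1/(1 - \<beta>\<^sup>2 tr\<^sub>n(D\<^sup>-\<^sup>2))\<close>. Weighting its diagonal with
  \<open>x\<^sub>i\<^sup>2\<close> returns \<open>tr\<^sub>n(R\<^sup>2)\<close>, and \<open>s - 1 = \<beta>\<^sup>2 tr\<^sub>n(D\<^sup>-\<^sup>2) s\<close>, so the defect has Frobenius norm \<open>O(1)\<close>
  (\<open>norm_F_defect_R\<close>). The rank-one term has Frobenius norm \<open>O(1)\<close>, so by the first idea the defect
  of \<open>Q\<close> is \<open>O(1)\<close> too, and \<open>f(m) - m\<close> is this diagonal matrix applied to \<open>m\<close>, a vector of the cube,
  up to a small remainder. So \<open>f(m) - m\<close> is \<open>O(1)\<close>. Together with the first idea this bounds the variation of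
  \<open>Q (m - f(m))\<close>: the variation of \<open>Q\<close> acts on a vector of size \<open>O(1)\<close> instead of \<open>\<surd>n\<close>.

  \<^emph>\<open>A detour through the admissible set.\<close> The gradient of \<open>\<omega>\<close> is \<open>m - f(m)\<close>, which is bounded, but
  integrating it needs a path. Up to an explicit Lipschitz term coming from the rank-one part, \<open>\<omega>\<close> is
  a function of \<open>x\<close> alone, namely \<open>Tr R(x) - \<Sum> x\<^sub>i\<close> up to affine rescaling. This function has the defect of
  \<open>R\<close> as its gradient on the larger set of \<open>x\<close> in \<open>(0,1]\<^sup>n\<close> with \<open>Y(x) \<ge> c I\<close>. That set need not be
  convex either, but shrinking all coordinates by a common factor increases \<open>Y\<close> by a definite amount because
  \<open>\<beta> < 1\<close>. This pays for then moving to the coordinatewise minimum of two points: both \<open>x\<close> and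
  \<open>x'\<close> reach a common multiple of \<open>min(x, x')\<close> by two straight segments inside the set, of total length
  \<open>O(\<parallel>x - x'\<parallel>)\<close> (\<open>potential_descend\<close>).
\<close>

section \<open>Euclidean and Frobenius norms\<close>

lemma vnorm_eq_L2_set: "vnorm v = L2_set (\<lambda>i. v $ i) {..<dim_vec v}"
  by (simp add: vnorm_def L2_set_def scalar_prod_def power2_eq_square atLeast0LessThan)

lemma norm_F_eq_L2_set:
  "norm_F X = L2_set (\<lambda>(i, j). X $$ (i, j)) ({..<dim_row X} \<times> {..<dim_col X})"
proof -
  have "mtrace (transpose_mat X * X) = (\<Sum>j<dim_col X. \<Sum>i<dim_row X. (X $$ (i, j))\<^sup>2)"
    unfolding mtrace_def
    by (rule sum.cong) (auto simp: scalar_prod_def power2_eq_square atLeast0LessThan)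
  also have "\<dots> = (\<Sum>i<dim_row X. \<Sum>j<dim_col X. (X $$ (i, j))\<^sup>2)"
    by (rule sum.swap)
  also have "\<dots> = (\<Sum>p\<in>{..<dim_row X} \<times> {..<dim_col X}. (case p of (i, j) \<Rightarrow> X $$ (i, j))\<^sup>2)"
    by (simp add: sum.cartesian_product case_prod_beta')
  finally show ?thesis
    by (simp add: norm_F_def L2_set_def)
qed

lemma vnorm_nonneg [simp]: "0 \<le> vnorm v"
  by (simp add: vnorm_eq_L2_set)

lemma norm_F_nonneg [simp]: "0 \<le> norm_F X"
  by (simp add: norm_F_eq_L2_set)

lemma vnorm_square: "(vnorm v)\<^sup>2 = v \<bullet> v"
  unfolding vnorm_def by (rule real_sqrt_pow2) (simp add: scalar_prod_def sum_nonneg)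

lemma vnorm_square_sum: "(vnorm v)\<^sup>2 = (\<Sum>i<dim_vec v. (v $ i)\<^sup>2)"
  by (simp add: vnorm_square) (simp add: scalar_prod_def power2_eq_square atLeast0LessThan)

lemma abs_sum_mult_le_L2_set: "\<bar>\<Sum>i\<in>S. f i * g i\<bar> \<le> L2_set f S * L2_set g S"
proof -
  have "\<bar>\<Sum>i\<in>S. f i * g i\<bar> \<le> (\<Sum>i\<in>S. \<bar>f i\<bar> * \<bar>g i\<bar>)"
    by (rule order_trans[OF sum_abs]) (simp add: abs_mult)
  also have "\<dots> \<le> L2_set f S * L2_set g S"
    by (rule L2_set_mult_ineq)
  finally show ?thesis .
qed

lemma abs_scalar_prod_le:
  assumes "u \<in> carrier_vec n" "v \<in> carrier_vec n"
  shows "\<bar>u \<bullet> v\<bar> \<le> vnorm u * vnorm v"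
  using abs_sum_mult_le_L2_set[of "\<lambda>i. u $ i" "\<lambda>i. v $ i" "{..<n}"] assms
  by (simp add: vnorm_eq_L2_set scalar_prod_def atLeast0LessThan)

lemma vnorm_add_le:
  assumes "u \<in> carrier_vec n" "v \<in> carrier_vec n"
  shows "vnorm (u + v) \<le> vnorm u + vnorm v"
proof -
  have "vnorm (u + v) = L2_set (\<lambda>i. u $ i + v $ i) {..<n}"
    using assms by (auto simp: vnorm_eq_L2_set intro!: L2_set_cong)
  then show ?thesis
    using L2_set_triangle_ineq[of "\<lambda>i. u $ i" "\<lambda>i. v $ i" "{..<n}"] assms
    by (simp add: vnorm_eq_L2_set)
qed

lemma L2_set_scale: "L2_set (\<lambda>i. a * f i) S = \<bar>a\<bar> * L2_set f S"
  by (simp add: L2_set_def power_mult_distrib real_sqrt_mult flip: sum_distrib_left)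

lemma vnorm_smult: "vnorm (a \<cdot>\<^sub>v v) = \<bar>a\<bar> * vnorm v"
proof -
  have "vnorm (a \<cdot>\<^sub>v v) = L2_set (\<lambda>i. a * v $ i) {..<dim_vec v}"
    by (auto simp: vnorm_eq_L2_set intro!: L2_set_cong)
  then show ?thesis
    by (simp add: vnorm_eq_L2_set L2_set_scale)
qed

lemma vnorm_minus_commute:
  assumes "u \<in> carrier_vec n" "v \<in> carrier_vec n"
  shows "vnorm (u - v) = vnorm (v - u)"
proof -
  have "u - v = (-1) \<cdot>\<^sub>v (v - u)"
    using assms by (intro eq_vecI) auto
  then show ?thesis
    using vnorm_smult[of "-1" "v - u"] by simp
qed

lemma vnorm_diff_le:
  assumes "u \<in> carrier_vec n" "v \<in> carrier_vec n"
  shows "vnorm (u - v) \<le> vnorm u + vnorm v"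
proof -
  have "u - v = u + (-1) \<cdot>\<^sub>v v"
    using assms by (intro eq_vecI) auto
  then show ?thesis
    using vnorm_add_le[of u n "(-1) \<cdot>\<^sub>v v"] vnorm_smult[of "-1" v] assms by simp
qed

lemma vnorm_zero [simp]: "vnorm (0\<^sub>v n) = 0"
  by (simp add: vnorm_def)

lemma vnorm_eq_0D:
  assumes "v \<in> carrier_vec n" "vnorm v = 0"
  shows "v = 0\<^sub>v n"
  using assms by (intro eq_vecI) (auto simp: vnorm_eq_L2_set L2_set_eq_0_iff)

lemma vnorm_le_sqrt_dim:
  assumes "v \<in> carrier_vec n" "\<And>i. i < n \<Longrightarrow> \<bar>v $ i\<bar> \<le> 1"
  shows "vnorm v \<le> sqrt (real n)"
proof -
  have "(\<Sum>i<n. (v $ i)\<^sup>2) \<le> (\<Sum>i<n. 1)"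
    using assms(2) by (intro sum_mono) (simp add: abs_square_le_1)
  then show ?thesis
    using assms(1) by (simp add: vnorm_eq_L2_set L2_set_def)
qed

lemma vnorm_mono:
  assumes "u \<in> carrier_vec n" "v \<in> carrier_vec n" "\<And>i. i < n \<Longrightarrow> \<bar>u $ i\<bar> \<le> \<bar>v $ i\<bar>"
  shows "vnorm u \<le> vnorm v"
  using assms
  by (auto simp: vnorm_eq_L2_set L2_set_def abs_le_square_iff intro!: sum_mono)

lemma abs_vec_sum_le:
  assumes "v \<in> carrier_vec n"
  shows "(\<Sum>i<n. \<bar>v $ i\<bar>) \<le> sqrt (real n) * vnorm v"
  using L2_set_mult_ineq[of "\<lambda>i. 1" "\<lambda>i. v $ i" "{..<n}"] assms
  by (simp add: vnorm_eq_L2_set L2_set_def)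

lemma norm_F_square_cols:
  assumes "X \<in> carrier_mat n m"
  shows "(norm_F X)\<^sup>2 = (\<Sum>j<m. (vnorm (col X j))\<^sup>2)"
proof -
  have "mtrace (transpose_mat X * X) = (\<Sum>j<m. (vnorm (col X j))\<^sup>2)"
    using assms by (auto simp: mtrace_def vnorm_square intro!: sum.cong)
  moreover have "0 \<le> (\<Sum>j<m. (vnorm (col X j))\<^sup>2)"
    by (intro sum_nonneg) simp
  ultimately show ?thesis
    by (simp add: norm_F_def)
qed

lemma norm_F_transpose [simp]: "norm_F (transpose_mat X) = norm_F X"
proof -
  have "(\<Sum>p\<in>{..<dim_col X} \<times> {..<dim_row X}. (case p of (i, j) \<Rightarrow> X $$ (j, i))\<^sup>2)
      = (\<Sum>p\<in>{..<dim_row X} \<times> {..<dim_col X}. (case p of (i, j) \<Rightarrow> X $$ (i, j))\<^sup>2)"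
    by (rule sum.reindex_bij_witness[where i = prod.swap and j = prod.swap]) auto
  moreover have "norm_F (transpose_mat X)
      = L2_set (\<lambda>(i, j). X $$ (j, i)) ({..<dim_col X} \<times> {..<dim_row X})"
    by (auto simp: norm_F_eq_L2_set intro!: L2_set_cong)
  ultimately show ?thesis
    by (simp add: norm_F_eq_L2_set L2_set_def)
qed

lemma norm_F_add_le:
  assumes "X \<in> carrier_mat n m" "Y \<in> carrier_mat n m"
  shows "norm_F (X + Y) \<le> norm_F X + norm_F Y"
proof -
  have "norm_F (X + Y)
      = L2_set (\<lambda>p. (case p of (i, j) \<Rightarrow> X $$ (i, j)) + (case p of (i, j) \<Rightarrow> Y $$ (i, j))) ({..<n} \<times> {..<m})"
    using assms by (auto simp: norm_F_eq_L2_set intro!: L2_set_cong)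
  then show ?thesis
    using L2_set_triangle_ineq[of "\<lambda>(i, j). X $$ (i, j)" "\<lambda>(i, j). Y $$ (i, j)" "{..<n} \<times> {..<m}"]
      assms by (simp add: norm_F_eq_L2_set)
qed

lemma norm_F_smult: "norm_F (a \<cdot>\<^sub>m X) = \<bar>a\<bar> * norm_F X"
proof -
  have "norm_F (a \<cdot>\<^sub>m X)
      = L2_set (\<lambda>p. a * (case p of (i, j) \<Rightarrow> X $$ (i, j))) ({..<dim_row X} \<times> {..<dim_col X})"
    by (auto simp: norm_F_eq_L2_set intro!: L2_set_cong)
  then show ?thesis
    by (simp add: norm_F_eq_L2_set L2_set_scale)
qed

lemma norm_F_diff_le:
  assumes "X \<in> carrier_mat n m" "Y \<in> carrier_mat n m"
  shows "norm_F (X - Y) \<le> norm_F X + norm_F Y"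
proof -
  have "X - Y = X + (-1) \<cdot>\<^sub>m Y"
    using assms by (intro eq_matI) auto
  then show ?thesis
    using norm_F_add_le[of X n m "(-1) \<cdot>\<^sub>m Y"] norm_F_smult[of "-1" Y] assms by simp
qed

lemma norm_F_minus_commute:
  assumes "X \<in> carrier_mat n m" "Y \<in> carrier_mat n m"
  shows "norm_F (X - Y) = norm_F (Y - X)"
proof -
  have "X - Y = (-1) \<cdot>\<^sub>m (Y - X)"
    using assms by (intro eq_matI) auto
  then show ?thesis
    using norm_F_smult[of "-1" "Y - X"] by simp
qed

lemma norm_F_one: "norm_F (1\<^sub>m n) = sqrt (real n)"
  by (simp add: norm_F_def mtrace_def)

lemma norm_F_outer:
  assumes "u \<in> carrier_vec n" "v \<in> carrier_vec n"
  shows "norm_F (outer u v) = vnorm u * vnorm v"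
proof -
  have "norm_F (outer u v) = sqrt (\<Sum>i<n. \<Sum>j<n. (u $ i)\<^sup>2 * (v $ j)\<^sup>2)"
    using assms by (auto simp: norm_F_eq_L2_set L2_set_def outer_def sum.cartesian_product
        power_mult_distrib intro!: sum.cong)
  then show ?thesis
    using assms by (simp add: vnorm_eq_L2_set L2_set_def real_sqrt_mult flip: sum_product)
qed

lemma norm_F_mat_diag: "norm_F (mat_diag n f) = L2_set f {..<n}"
proof -
  have "mtrace (transpose_mat (mat_diag n f) * mat_diag n f) = (\<Sum>i<n. (f i)\<^sup>2)"
  proof -
    have "transpose_mat (mat_diag n f) = mat_diag n f"
      by (intro eq_matI) (auto simp: mat_diag_def)
    then show ?thesis
      by (simp add: mtrace_def) (simp add: mat_diag_def power2_eq_square)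
  qed
  then show ?thesis by (simp add: norm_F_def L2_set_def)
qed

lemma norm_F_diag_proj_le:
  assumes "X \<in> carrier_mat n n"
  shows "norm_F (diag_proj X) \<le> norm_F X"
  using assms unfolding norm_F_eq_L2_set
  by (auto simp: diag_proj_def L2_set_def intro!: sum_mono)

text \<open>
  The Cauchy--Schwarz inequality for the Hilbert--Schmidt pairing of \<open>X\<close> with the transpose of \<open>Y\<close>.
\<close>

lemma abs_mtrace_mult_le:
  assumes X: "X \<in> carrier_mat n n" and Y: "Y \<in> carrier_mat n n"
  shows "\<bar>mtrace (X * Y)\<bar> \<le> norm_F X * norm_F Y"
proof -
  have "mtrace (X * Y) = (\<Sum>i<n. \<Sum>j<n. X $$ (i, j) * Y $$ (j, i))"
    using X Y by (auto simp: mtrace_def scalar_prod_def atLeast0LessThan intro!: sum.cong)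
  also have "\<dots> = (\<Sum>p\<in>{..<n} \<times> {..<n}. (case p of (i, j) \<Rightarrow> X $$ (i, j))
      * (case p of (i, j) \<Rightarrow> transpose_mat Y $$ (i, j)))"
    using X Y by (auto simp: sum.cartesian_product intro!: sum.cong)
  finally have "\<bar>mtrace (X * Y)\<bar> \<le> norm_F X * norm_F (transpose_mat Y)"
    using abs_sum_mult_le_L2_set[of "\<lambda>(i, j). X $$ (i, j)" "\<lambda>(i, j). transpose_mat Y $$ (i, j)"
        "{..<n} \<times> {..<n}"] X Y
    by (simp add: norm_F_eq_L2_set[of X] norm_F_eq_L2_set[of "transpose_mat Y"] del: norm_F_transpose)
  then show ?thesis by simp
qed

lemma abs_mtrace_le:
  assumes "X \<in> carrier_mat n n"
  shows "\<bar>mtrace X\<bar> \<le> sqrt (real n) * norm_F X"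
  using abs_mtrace_mult_le[of X n "1\<^sub>m n"] assms by (simp add: norm_F_one mult.commute)

lemma vnorm_mult_mat_vec_le:
  assumes X: "X \<in> carrier_mat n n" and v: "v \<in> carrier_vec n"
  shows "vnorm (X *\<^sub>v v) \<le> norm_F X * vnorm v"
proof -
  have "(vnorm (X *\<^sub>v v))\<^sup>2 = (\<Sum>i<n. (row X i \<bullet> v)\<^sup>2)"
    using X by (simp add: vnorm_square_sum)
  also have "\<dots> \<le> (\<Sum>i<n. (vnorm (row X i) * vnorm v)\<^sup>2)"
    using abs_scalar_prod_le[OF _ v] X
    by (intro sum_mono) (metis (no_types, lifting) abs_ge_zero power2_abs power_mono row_carrier_vec lessThan_iff)
  also have "\<dots> = (norm_F (transpose_mat X))\<^sup>2 * (vnorm v)\<^sup>2"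
    using X by (simp add: norm_F_square_cols[of _ n n] power_mult_distrib sum_distrib_right
        del: norm_F_transpose)
  finally show ?thesis
    by (simp add: flip: power_mult_distrib)
qed

section \<open>Operator bounds and inverses of coercive matrices\<close>

text \<open>
  An inequality rather than a norm: every estimate below only needs an upper bound, and bounds
  can be composed without computing suprema.
\<close>

definition op_bound :: "nat \<Rightarrow> real \<Rightarrow> real mat \<Rightarrow> bool" where
  "op_bound n k X \<longleftrightarrow> 0 \<le> k \<and> X \<in> carrier_mat n n \<and>
     (\<forall>v\<in>carrier_vec n. vnorm (X *\<^sub>v v) \<le> k * vnorm v)"

lemma op_boundD:
  assumes "op_bound n k X"
  shows "0 \<le> k" "X \<in> carrier_mat n n" "v \<in> carrier_vec n \<Longrightarrow> vnorm (X *\<^sub>v v) \<le> k * vnorm v"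
  using assms by (auto simp: op_bound_def)

lemma op_bound_mono: "op_bound n k X \<Longrightarrow> k \<le> l \<Longrightarrow> op_bound n l X"
  unfolding op_bound_def by (meson mult_right_mono order_trans vnorm_nonneg)

lemma op_bound_norm_F: "X \<in> carrier_mat n n \<Longrightarrow> op_bound n (norm_F X) X"
  by (simp add: op_bound_def vnorm_mult_mat_vec_le)

lemma op_bound_one: "op_bound n 1 (1\<^sub>m n)"
  by (simp add: op_bound_def)

lemma op_bound_smult:
  assumes "op_bound n k X"
  shows "op_bound n (\<bar>a\<bar> * k) (a \<cdot>\<^sub>m X)"
proof -
  have "vnorm ((a \<cdot>\<^sub>m X) *\<^sub>v v) \<le> \<bar>a\<bar> * k * vnorm v" if "v \<in> carrier_vec n" for v
  proof -
    have "(a \<cdot>\<^sub>m X) *\<^sub>v v = a \<cdot>\<^sub>v (X *\<^sub>v v)"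
      using op_boundD(2)[OF assms] that by (intro eq_vecI) auto
    then show ?thesis
      using mult_left_mono[OF op_boundD(3)[OF assms that], of "\<bar>a\<bar>"] by (simp add: vnorm_smult)
  qed
  then show ?thesis
    using op_boundD(1,2)[OF assms] by (simp add: op_bound_def)
qed

lemma op_bound_add:
  assumes X: "op_bound n k X" and Y: "op_bound n l Y"
  shows "op_bound n (k + l) (X + Y)"
  unfolding op_bound_def
proof (intro conjI ballI)
  fix v :: "real vec" assume v: "v \<in> carrier_vec n"
  have "(X + Y) *\<^sub>v v = X *\<^sub>v v + Y *\<^sub>v v"
    using op_boundD(2)[OF X] op_boundD(2)[OF Y] v by (rule add_mult_distrib_mat_vec)
  moreover have "vnorm (X *\<^sub>v v + Y *\<^sub>v v) \<le> vnorm (X *\<^sub>v v) + vnorm (Y *\<^sub>v v)"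
    using op_boundD(2)[OF X] op_boundD(2)[OF Y] v by (intro vnorm_add_le[of _ n]) auto
  ultimately show "vnorm ((X + Y) *\<^sub>v v) \<le> (k + l) * vnorm v"
    using op_boundD(3)[OF X v] op_boundD(3)[OF Y v] by (simp add: distrib_right)
qed (use op_boundD[OF X] op_boundD[OF Y] in auto)

lemma op_bound_diff:
  assumes X: "op_bound n k X" and Y: "op_bound n l Y"
  shows "op_bound n (k + l) (X - Y)"
proof -
  have "X - Y = X + (-1) \<cdot>\<^sub>m Y"
    using op_boundD(2)[OF X] op_boundD(2)[OF Y] by (intro eq_matI) auto
  then show ?thesis
    using op_bound_add[OF X op_bound_smult[OF Y, of "-1"]] by simp
qed

lemma op_bound_mult:
  assumes X: "op_bound n k X" and Y: "op_bound n l Y"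
  shows "op_bound n (k * l) (X * Y)"
  unfolding op_bound_def
proof (intro conjI ballI)
  fix v :: "real vec" assume v: "v \<in> carrier_vec n"
  have "vnorm (X *\<^sub>v (Y *\<^sub>v v)) \<le> k * vnorm (Y *\<^sub>v v)"
    using op_boundD(2)[OF Y] v by (intro op_boundD(3)[OF X]) auto
  also have "\<dots> \<le> k * (l * vnorm v)"
    using op_boundD(3)[OF Y v] op_boundD(1)[OF X] by (rule mult_left_mono)
  finally show "vnorm ((X * Y) *\<^sub>v v) \<le> k * l * vnorm v"
    using op_boundD(2)[OF X] op_boundD(2)[OF Y] v by simp
qed (use op_boundD[OF X] op_boundD[OF Y] in auto)

text \<open>
  The columns of \<open>X Y\<close> are the images under \<open>X\<close> of the columns of \<open>Y\<close>.
\<close>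

lemma norm_F_mult_le:
  assumes X: "op_bound n k X" and Y: "Y \<in> carrier_mat n n"
  shows "norm_F (X * Y) \<le> k * norm_F Y"
proof -
  have "(norm_F (X * Y))\<^sup>2 = (\<Sum>j<n. (vnorm (X *\<^sub>v col Y j))\<^sup>2)"
    using op_boundD(2)[OF X] Y by (simp add: norm_F_square_cols[of _ n n] col_mult2[of X n n Y n] del: col_mult)
  also have "\<dots> \<le> (\<Sum>j<n. (k * vnorm (col Y j))\<^sup>2)"
    using Y by (intro sum_mono power_mono op_boundD(3)[OF X]) auto
  also have "\<dots> = (k * norm_F Y)\<^sup>2"
    using Y by (simp add: power_mult_distrib norm_F_square_cols[of _ n n] sum_distrib_left)
  finally show ?thesis
    using op_boundD(1)[OF X] by (simp add: power2_le_iff_abs_le)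
qed

text \<open>Bounds pass to the adjoint: @ @ \<close>

text \<open>
  With \<open>w = X\<^sup>T v\<close> one has \<open>\<parallel>w\<parallel>\<^sup>2 = \<langle>v, X w\<rangle> \<le> k \<parallel>v\<parallel> \<parallel>w\<parallel>\<close>; divide by \<open>\<parallel>w\<parallel>\<close>.
\<close>

lemma op_bound_transpose:
  assumes X: "op_bound n k X"
  shows "op_bound n k (transpose_mat X)"
  unfolding op_bound_def
proof (intro conjI ballI)
  note Xc = op_boundD(2)[OF X]
  fix v :: "real vec" assume v: "v \<in> carrier_vec n"
  define w where "w = transpose_mat X *\<^sub>v v"
  have w: "w \<in> carrier_vec n"
    using Xc v by (simp add: w_def)
  have "(vnorm w)\<^sup>2 = v \<bullet> (X *\<^sub>v w)"
    using transpose_vec_mult_scalar[OF Xc w v] comm_scalar_prod[OF v, of "X *\<^sub>v w"] 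
      comm_scalar_prod[OF w w] Xc w v
    by (simp add: vnorm_square w_def[symmetric]) 
  also have "\<dots> \<le> vnorm v * vnorm (X *\<^sub>v w)"
    using abs_scalar_prod_le[OF v, of "X *\<^sub>v w"] Xc w by simp
  also have "\<dots> \<le> vnorm v * (k * vnorm w)"
    by (intro mult_left_mono op_boundD(3)[OF X w]) simp
  finally have "vnorm w * vnorm w \<le> (k * vnorm v) * vnorm w"
    by (simp add: power2_eq_square mult_ac)
  then show "vnorm (transpose_mat X *\<^sub>v v) \<le> k * vnorm v"
    unfolding w_def[symmetric] using op_boundD(1)[OF X]
    by (metis less_eq_real_def mult_le_cancel_right_pos mult_nonneg_nonneg vnorm_nonneg)
qed (use op_boundD[OF X] in auto)

lemma norm_F_mult_le':
  assumes Y: "Y \<in> carrier_mat n n" and X: "op_bound n k X"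
  shows "norm_F (Y * X) \<le> k * norm_F Y"
proof -
  have "norm_F (Y * X) = norm_F (transpose_mat X * transpose_mat Y)"
    using Y op_boundD(2)[OF X] by (metis norm_F_transpose transpose_mult)
  also have "\<dots> \<le> k * norm_F (transpose_mat Y)"
    using Y by (intro norm_F_mult_le[of n] op_bound_transpose X) simp
  finally show ?thesis by simp
qed

lemma norm_F_le_op_bound:
  assumes "op_bound n k X"
  shows "norm_F X \<le> k * sqrt (real n)"
  using norm_F_mult_le[OF assms, of "1\<^sub>m n"] op_boundD(2)[OF assms] by (simp add: norm_F_one)

lemma op_bound_norm_op:
  assumes X: "X \<in> carrier_mat n n" and "norm_op X \<le> k" "0 \<le> k"
  shows "op_bound n k X"
  unfolding op_bound_def
proof (intro conjI ballI)
  fix v :: "real vec" assume v: "v \<in> carrier_vec n"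
  let ?S = "{v \<in> carrier_vec n. vnorm v \<le> 1}"
  have bdd: "bdd_above ((\<lambda>v. vnorm (X *\<^sub>v v)) ` ?S)"
  proof (rule bdd_aboveI2)
    fix u assume u: "u \<in> ?S"
    then have "vnorm (X *\<^sub>v u) \<le> norm_F X * vnorm u"
      using X by (intro vnorm_mult_mat_vec_le) auto
    also have "\<dots> \<le> norm_F X * 1"
      using u by (intro mult_left_mono) auto
    finally show "vnorm (X *\<^sub>v u) \<le> norm_F X" by simp
  qed
  show "vnorm (X *\<^sub>v v) \<le> k * vnorm v"
  proof (cases "vnorm v = 0")
    case True
    then have "v = 0\<^sub>v n" using v by (intro vnorm_eq_0D)
    then have "X *\<^sub>v v = 0\<^sub>v n" using X by (intro eq_vecI) auto
    then show ?thesis using assms(3) by simp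
  next
    case False
    let ?u = "(1 / vnorm v) \<cdot>\<^sub>v v"
    have "?u \<in> ?S"
      using v False by (simp add: vnorm_smult)
    then have "vnorm (X *\<^sub>v ?u) \<le> k"
      using cSUP_upper[OF _ bdd, of ?u] X assms(2) by (simp add: norm_op_def)
    moreover have "X *\<^sub>v ?u = (1 / vnorm v) \<cdot>\<^sub>v (X *\<^sub>v v)"
      using X v by (rule mult_mat_vec)
    ultimately show ?thesis
      using False vnorm_nonneg[of v] by (simp add: vnorm_smult pos_divide_le_eq less_le)
  qed
qed (use assms in auto)

text \<open>
  A diagonal matrix applied to a vector of the cube costs only its Frobenius norm, without the
  factor \<open>\<surd>n\<close> that the norm of the vector would contribute. This is what makes the drift estimates
  independent of the dimension.
\<close>

lemma vnorm_mat_diag_mult_le: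
  assumes v: "v \<in> carrier_vec n" and "\<And>i. i < n \<Longrightarrow> \<bar>v $ i\<bar> \<le> 1"
  shows "vnorm (mat_diag n f *\<^sub>v v) \<le> norm_F (mat_diag n f)"
proof -
  have *: "(mat_diag n f *\<^sub>v v) $ i = f i * v $ i" if "i < n" for i
    using that v by (simp add: mat_diag_def scalar_prod_def if_distrib[of "\<lambda>x. x * _"] cong: if_cong)
  have "(f i * v $ i)\<^sup>2 \<le> (f i)\<^sup>2" if "i < n" for i
    using assms(2)[OF that] by (simp add: power_mult_distrib mult_left_le abs_square_le_1)
  then have "(\<Sum>i<n. ((mat_diag n f *\<^sub>v v) $ i)\<^sup>2) \<le> (\<Sum>i<n. (f i)\<^sup>2)"
    by (intro sum_mono) (simp add: *)
  then show ?thesis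
    by (simp add: norm_F_mat_diag vnorm_eq_L2_set L2_set_def) (simp add: mat_diag_def)
qed

lemma mtrace_comm:
  assumes "X \<in> carrier_mat n n" "Y \<in> carrier_mat n n"
  shows "mtrace (X * Y) = mtrace (Y * X)"
proof -
  have "mtrace (X * Y) = (\<Sum>i<n. \<Sum>j<n. X $$ (i, j) * Y $$ (j, i))"
    using assms by (auto simp: mtrace_def scalar_prod_def atLeast0LessThan intro!: sum.cong)
  also have "\<dots> = (\<Sum>j<n. \<Sum>i<n. X $$ (i, j) * Y $$ (j, i))"
    by (rule sum.swap)
  also have "\<dots> = mtrace (Y * X)"
    using assms by (auto simp: mtrace_def scalar_prod_def atLeast0LessThan mult.commute intro!: sum.cong)
  finally show ?thesis .
qed

lemma mtrace_add: "X \<in> carrier_mat n n \<Longrightarrow> Y \<in> carrier_mat n n \<Longrightarrow> mtrace (X + Y) = mtrace X + mtrace Y"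
  by (simp add: mtrace_def sum.distrib)

lemma mtrace_diff: "X \<in> carrier_mat n n \<Longrightarrow> Y \<in> carrier_mat n n \<Longrightarrow> mtrace (X - Y) = mtrace X - mtrace Y"
  by (simp add: mtrace_def sum_subtractf)

lemma mtrace_smult: "X \<in> carrier_mat n n \<Longrightarrow> mtrace (a \<cdot>\<^sub>m X) = a * mtrace X"
  by (simp add: mtrace_def sum_distrib_left)

text \<open>
  Coercivity gives \<open>c \<parallel>v\<parallel> \<le> \<parallel>H v\<parallel>\<close>, hence a trivial kernel and the bound on the inverse.
\<close>

lemma minv_inverse:
  assumes H: "H \<in> carrier_mat n n" and c: "0 < c"
    and coercive: "\<And>v. v \<in> carrier_vec n \<Longrightarrow> c * (vnorm v)\<^sup>2 \<le> v \<bullet> (H *\<^sub>v v)"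
  shows "H * minv H = 1\<^sub>m n" "minv H * H = 1\<^sub>m n" "op_bound n (1 / c) (minv H)"
proof -
  have lower: "c * vnorm v \<le> vnorm (H *\<^sub>v v)" if v: "v \<in> carrier_vec n" for v
  proof -
    have "(c * vnorm v) * vnorm v \<le> vnorm (H *\<^sub>v v) * vnorm v"
      using coercive[OF v] abs_scalar_prod_le[OF v, of "H *\<^sub>v v"] H v
      by (simp add: power2_eq_square mult_ac)
    then show ?thesis
      by (metis less_eq_real_def mult_le_cancel_right_pos mult_zero_right vnorm_nonneg)
  qed
  have "det H \<noteq> 0"
  proof
    assume "det H = 0"
    then obtain v where v: "v \<in> carrier_vec n" "v \<noteq> 0\<^sub>v n" "H *\<^sub>v v = 0\<^sub>v n"
      using det_0_iff_vec_prod_zero_field[OF H] by auto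
    with lower[of v] c have "vnorm v \<le> 0" by (simp add: mult_le_0_iff)
    with vnorm_nonneg[of v] vnorm_eq_0D[OF v(1)] v(2) show False by linarith
  qed
  then have "H \<in> Units (ring_mat TYPE(real) n ())"
    by (rule det_non_zero_imp_unit[OF H])
  then obtain B where B: "mat_inverse H = Some B"
    using mat_inverse(1)[OF H, of "()"] by (cases "mat_inverse H") auto
  then have eq: "minv H = B" by (simp add: minv_def)
  show HB: "H * minv H = 1\<^sub>m n" and "minv H * H = 1\<^sub>m n"
    using mat_inverse(2)[OF H B] eq by auto
  have Bc: "minv H \<in> carrier_mat n n"
    using mat_inverse(2)[OF H B] eq by auto
  show "op_bound n (1 / c) (minv H)"
    unfolding op_bound_def
  proof (intro conjI ballI)
    fix v :: "real vec" assume v: "v \<in> carrier_vec n"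
    have "H *\<^sub>v (minv H *\<^sub>v v) = v"
      using H Bc v HB by (simp flip: assoc_mult_mat_vec)
    then have "c * vnorm (minv H *\<^sub>v v) \<le> vnorm v"
      using lower[of "minv H *\<^sub>v v"] Bc v by simp
    then show "vnorm (minv H *\<^sub>v v) \<le> 1 / c * vnorm v"
      using c by (simp add: field_simps)
  qed (use c Bc in auto)
qed

lemma minv_eqI:
  assumes X: "X \<in> carrier_mat n n" and Z: "Z \<in> carrier_mat n n" and XZ: "X * Z = 1\<^sub>m n"
  shows "minv X = Z"
proof -
  have ZX: "Z * X = 1\<^sub>m n"
    by (rule mat_mult_left_right_inverse[OF X Z XZ])
  then have "X \<in> Units (ring_mat TYPE(real) n ())"
    using X Z XZ by (auto simp: Units_def ring_mat_def)
  then obtain B where B: "mat_inverse X = Some B"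
    using mat_inverse(1)[OF X, of "()"] by (cases "mat_inverse X") auto
  from mat_inverse(2)[OF X B] have B': "B * X = 1\<^sub>m n" "B \<in> carrier_mat n n" by auto
  have "B = B * (X * Z)" using B' XZ by simp
  also have "\<dots> = (B * X) * Z" using B' X Z by (metis assoc_mult_mat)
  also have "\<dots> = Z" unfolding B' using Z by simp
  finally show ?thesis using B by (simp add: minv_def)
qed

lemma minv_transpose:
  assumes H: "H \<in> carrier_mat n n" and "transpose_mat H = H" "H * R = 1\<^sub>m n"
    and R: "(R :: real mat) \<in> carrier_mat n n"
  shows "transpose_mat R = R"
proof -
  have "transpose_mat R * H = 1\<^sub>m n"
    using transpose_mult[OF H R] assms by simp
  moreover have "transpose_mat R * (H * R) = (transpose_mat R * H) * R"
    using H R by (intro assoc_mult_mat[symmetric]) auto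
  ultimately show ?thesis
    using assms by simp
qed

section \<open>Perturbation of resolvents with a singular diagonal part\<close>

lemma abs_ntrace_le:
  assumes "X \<in> carrier_mat n n"
  shows "\<bar>ntrace X\<bar> * sqrt (real n) \<le> norm_F X"
proof (cases "n = 0")
  case False
  have "\<bar>ntrace X\<bar> * sqrt (real n) = \<bar>mtrace X\<bar> / sqrt (real n)"
    using assms False by (simp add: ntrace_def abs_divide field_simps)
  also have "\<dots> \<le> norm_F X"
    using abs_mtrace_le[OF assms] False by (simp add: pos_divide_le_eq mult.commute)
  finally show ?thesis .
qed simp

text \<open>
  A mean over \<open>n\<close> coordinates moves by at most \<open>1/\<surd>n\<close> times the Euclidean distance; the factor
  \<open>\<surd>n\<close> is the Frobenius norm of the identity matrix that the mean multiplies later on.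
\<close>

lemma abs_mean_diff_le:
  assumes "x \<in> carrier_vec n" "y \<in> carrier_vec n"
  shows "\<bar>(\<Sum>i<n. x $ i - y $ i) / real n\<bar> * sqrt (real n) \<le> vnorm (x - y)"
proof (cases "n = 0")
  case False
  have "\<bar>\<Sum>i<n. x $ i - y $ i\<bar> \<le> (\<Sum>i<n. \<bar>(x - y) $ i\<bar>)"
    using assms by (intro order_trans[OF sum_abs] sum_mono) auto
  also have "\<dots> \<le> sqrt (real n) * vnorm (x - y)"
    using assms by (intro abs_vec_sum_le) auto
  finally have "\<bar>\<Sum>i<n. x $ i - y $ i\<bar> / sqrt (real n) \<le> vnorm (x - y)"
    using False by (simp add: field_simps)
  moreover have "\<bar>(\<Sum>i<n. x $ i - y $ i) / real n\<bar> * sqrt (real n)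
      = \<bar>\<Sum>i<n. x $ i - y $ i\<bar> / sqrt (real n)"
    using False by (simp add: abs_divide field_simps)
  ultimately show ?thesis by simp
qed simp

lemma ntrace_diff:
  "X \<in> carrier_mat n n \<Longrightarrow> Y \<in> carrier_mat n n \<Longrightarrow> ntrace (X - Y) = ntrace X - ntrace Y"
  by (simp add: ntrace_def mtrace_diff diff_divide_distrib)

lemma diag_proj_carrier [simp]: "X \<in> carrier_mat n n \<Longrightarrow> diag_proj X \<in> carrier_mat n n"
  by (simp add: diag_proj_def)

lemma diag_proj_diff:
  "X \<in> carrier_mat n n \<Longrightarrow> Y \<in> carrier_mat n n \<Longrightarrow> diag_proj (X - Y) = diag_proj X - diag_proj Y"
  by (intro eq_matI) (auto simp: diag_proj_def)

lemma mtrace_mat_diag_mult: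
  "X \<in> carrier_mat n n \<Longrightarrow> mtrace (mat_diag n d * X) = (\<Sum>i<n. d i * X $$ (i, i))"
  by (simp add: mtrace_def mat_diag_mult_left[of X n n])

lemma square_carrier:
  fixes X Y :: "real mat"
  assumes "X \<in> carrier_mat n n" "Y \<in> carrier_mat n n"
  shows "X * Y \<in> carrier_mat n n" "X - Y \<in> carrier_mat n n" "X + Y \<in> carrier_mat n n"
  using assms by auto

lemma norm_F_mult_diff_le:
  assumes X: "X \<in> carrier_mat n n" and X': "op_bound n k X'"
    and Y: "op_bound n l Y" and Y': "Y' \<in> carrier_mat n n"
  shows "norm_F (X * Y - X' * Y') \<le> l * norm_F (X - X') + k * norm_F (Y - Y')"
proof -
  note carr = X op_boundD(2)[OF X'] op_boundD(2)[OF Y] Y'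
  have "X * Y - X' * Y' = (X - X') * Y + X' * (Y - Y')"
    using carr by (intro eq_matI) (auto simp: minus_mult_distrib_mat[of _ n n] mult_minus_distrib_mat[of _ n n])
  then have "norm_F (X * Y - X' * Y') \<le> norm_F ((X - X') * Y) + norm_F (X' * (Y - Y'))"
    using carr by (auto intro!: norm_F_add_le[of _ n n])
  also have "\<dots> \<le> l * norm_F (X - X') + k * norm_F (Y - Y')"
    using carr by (intro add_mono norm_F_mult_le[OF X'] norm_F_mult_le'[OF _ Y]) auto
  finally show ?thesis .
qed

lemma resolvent_identity:
  fixes R R' H H' :: "real mat"
  assumes "R \<in> carrier_mat n n" "R' \<in> carrier_mat n n" "H \<in> carrier_mat n n" "H' \<in> carrier_mat n n"
    and "R * H = 1\<^sub>m n" "H' * R' = 1\<^sub>m n"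
  shows "R - R' = R * (H' - H) * R'"
proof -
  have "R * (H' - H) * R' = R * H' * R' - R * H * R'"
    using assms(1-4) by (simp add: mult_minus_distrib_mat[of _ n n] minus_mult_distrib_mat[of _ n n])
  also have "R * H' * R' = R * (H' * R')"
    using assms(1-4) by (intro assoc_mult_mat) auto
  finally show ?thesis
    using assms by simp
qed

text \<open>
  The matrix whose product with \<open>m\<close> is \<open>f(m) - m\<close>, up to the term \<open>(2\<beta>\<^sup>2/n) Q\<^sup>2 m\<close>, when \<open>R\<close> is the
  inverse Hessian. Its diagonal is also the gradient in \<open>x\<close> of \<open>Tr R - \<Sum> x\<^sub>i\<close> when
  \<open>R\<^sup>-\<^sup>1 = \<beta>\<^sup>2 mean(x) I - \<beta> A + diag(1/x\<^sub>i)\<close>.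
\<close>

definition defect :: "real \<Rightarrow> real mat \<Rightarrow> real mat \<Rightarrow> real mat" where
  "defect \<beta> D R = diag_proj (D * (R * R) * D) - (1 + \<beta>\<^sup>2 * ntrace (R * R)) \<cdot>\<^sub>m 1\<^sub>m (dim_row R)"

text \<open>
  \<open>R\<close> is the inverse of \<open>G + diag(1/x\<^sub>i)\<close>. Bounds are assumed for \<open>G\<close> and \<open>R\<close>, while the entries \<open>1/x\<^sub>i\<close> can
  be as large as they like.
\<close>

locale resolvent =
  fixes n :: nat and c g :: real and x :: "real vec" and G R :: "real mat"
  assumes c_pos: "0 < c"
    and x_carrier: "x \<in> carrier_vec n"
    and x_pos: "\<And>i. i < n \<Longrightarrow> 0 < x $ i"
    and x_le_1: "\<And>i. i < n \<Longrightarrow> x $ i \<le> 1"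
    and G_bound: "op_bound n g G"
    and R_bound: "op_bound n (1 / c) R"
    and R_left: "R * (G + mat_diag n (\<lambda>i. 1 / x $ i)) = 1\<^sub>m n"
    and R_right: "(G + mat_diag n (\<lambda>i. 1 / x $ i)) * R = 1\<^sub>m n"
begin

abbreviation "D \<equiv> mat_diag n (\<lambda>i. 1 / x $ i)"

lemma carriers [simp]: "G \<in> carrier_mat n n" "R \<in> carrier_mat n n"
  using G_bound R_bound by (auto dest: op_boundD)

lemma dims [simp]: "dim_row G = n" "dim_col G = n" "dim_row R = n" "dim_col R = n"
  "dim_row D = n" "dim_col D = n"
  using carriers by (auto simp: mat_diag_def simp del: carriers)

lemmas square_simps = square_carrier[of _ n]
  mult_add_distrib_mat[where nr = n and n = n and nc = n]
  add_mult_distrib_mat[where nr = n and n = n and nc = n]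
  mult_minus_distrib_mat[where nr = n and n = n and nc = n]
  minus_mult_distrib_mat[where nr = n and n = n and nc = n]
  mult_smult_distrib[where nr = n and n = n and nc = n]
  mult_smult_assoc_mat[where nr = n and n = n and nc = n]
  assoc_mult_mat[where ?n\<^sub>1 = n and ?n\<^sub>2 = n and ?n\<^sub>3 = n and ?n\<^sub>4 = n]

lemma g_nonneg: "0 \<le> g"
  using G_bound by (rule op_boundD)

text \<open>
  Multiplying by the unbounded factor \<open>D\<close> is harmless next to \<open>R\<close>: it can be traded for \<open>G\<close>.
\<close>

lemma RD_eq: "R * D = 1\<^sub>m n - R * G"
proof -
  have "R * G + R * D = 1\<^sub>m n"
    using R_left by (simp add: square_simps)
  then have "1\<^sub>m n - R * G = R * G + R * D - R * G" by simp
  also have "\<dots> = R * D" by (intro eq_matI) auto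
  finally show ?thesis by simp
qed

lemma DR_eq: "D * R = 1\<^sub>m n - G * R"
proof -
  have "G * R + D * R = 1\<^sub>m n"
    using R_right by (simp add: square_simps)
  then have "1\<^sub>m n - G * R = G * R + D * R - G * R" by simp
  also have "\<dots> = D * R" by (intro eq_matI) auto
  finally show ?thesis by simp
qed

lemma RD_bound: "op_bound n (1 + g / c) (R * D)"
  using op_bound_diff[OF op_bound_one op_bound_mult[OF R_bound G_bound]] by (simp add: RD_eq)

lemma DR_bound: "op_bound n (1 + g / c) (D * R)"
  using op_bound_diff[OF op_bound_one op_bound_mult[OF G_bound R_bound]] by (simp add: DR_eq)

lemma defect_carrier [simp]: "defect \<beta> D R \<in> carrier_mat n n"
  by (simp add: defect_def square_carrier)

lemma norm_F_R: "norm_F R \<le> sqrt (real n) / c"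
  using norm_F_le_op_bound[OF R_bound] by simp

end

text \<open>
  Lipschitz constants, in Frobenius norm, of \<open>R\<close>, of \<open>R D\<close> and \<open>D R\<close>, and of the defect: when \<open>x\<close> moves by
  at most \<open>a\<close> and \<open>G\<close> by at most \<open>l a\<close>, these matrices move by at most the constant times \<open>a\<close>.
\<close>

definition lip_R :: "real \<Rightarrow> real \<Rightarrow> real \<Rightarrow> real" where
  "lip_R c g l = l / c\<^sup>2 + (1 + g / c)\<^sup>2"

definition lip_RD :: "real \<Rightarrow> real \<Rightarrow> real \<Rightarrow> real" where
  "lip_RD c g l = lip_R c g l * g + l / c"

definition lip_defect :: "real \<Rightarrow> real \<Rightarrow> real \<Rightarrow> real \<Rightarrow> real" where
  "lip_defect \<beta> c g l = 2 * (1 + g / c) * lip_RD c g l + 2 * \<beta>\<^sup>2 * lip_R c g l / c"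

text \<open>
  Two resolvents to be compared. The distance \<open>a\<close> is a free upper bound, so that the same
  lemmas serve for two different points and for two matrices \<open>G\<close>, \<open>G'\<close> at one point.
\<close>

locale resolvent_pair =
  p: resolvent n c g x G R + q: resolvent n c g y G' R'
  for n :: nat and c g :: real and x :: "real vec" and G R :: "real mat"
    and y :: "real vec" and G' R' :: "real mat" +
  fixes a l :: real
  assumes x_close: "vnorm (x - y) \<le> a"
    and G_close: "norm_F (G - G') \<le> l * a"
begin

lemma a_nonneg: "0 \<le> a"
  using x_close vnorm_nonneg[of "x - y"] by linarith

text \<open>
  The resolvent identity, with the difference of the diagonal parts written as
  \<open>D diag(x - y) D'\<close> so that each unbounded factor stands next to its resolvent.
\<close>

lemma resolvent_diff:
  "R - R' = R * (G' - G) * R' + (R * p.D) * mat_diag n (\<lambda>i. x $ i - y $ i) * (q.D * R')"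
proof -
  let ?\<Delta> = "mat_diag n (\<lambda>i. x $ i - y $ i)"
  have \<Delta>: "q.D - p.D = p.D * ?\<Delta> * q.D"
  proof -
    have "1 / y $ i - 1 / x $ i = 1 / x $ i * (x $ i - y $ i) * (1 / y $ i)" if "i < n" for i
      using p.x_pos[OF that] q.x_pos[OF that] by (simp add: field_simps)
    then show ?thesis
      by (simp only: mat_diag_diag) (intro eq_matI, auto simp: mat_diag_def)
  qed
  have "R - R' = R * ((G' + q.D) - (G + p.D)) * R'"
    by (intro resolvent_identity[of _ n]) (auto simp: p.R_left q.R_right)
  also have "(G' + q.D) - (G + p.D) = (G' - G) + (q.D - p.D)"
    by (intro eq_matI) (auto simp: mat_diag_def)
  also have "R * ((G' - G) + (q.D - p.D)) * R' = R * (G' - G) * R' + R * (q.D - p.D) * R'"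
    by (simp add: p.square_simps)
  also have "R * (q.D - p.D) * R' = (R * p.D) * ?\<Delta> * (q.D * R')"
    unfolding \<Delta> by (simp add: p.square_simps del: mat_diag_diag)
  finally show ?thesis .
qed

lemma norm_F_R_diff: "norm_F (R - R') \<le> lip_R c g l * a"
proof -
  let ?\<Delta> = "mat_diag n (\<lambda>i. x $ i - y $ i)"
  have [simp]: "R * p.D \<in> carrier_mat n n" "q.D * R' \<in> carrier_mat n n"
    by (auto intro: mult_carrier_mat[of _ n n])
  have "norm_F (R * (G' - G) * R') \<le> 1 / c * norm_F (R * (G' - G))"
    by (intro norm_F_mult_le'[of _ n] q.R_bound mult_carrier_mat[of _ n n]) auto
  also have "\<dots> \<le> 1 / c * (1 / c * norm_F (G' - G))"
    using p.c_pos by (intro mult_left_mono norm_F_mult_le[of n] p.R_bound) auto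
  also have "\<dots> = norm_F (G - G') / c\<^sup>2"
    by (simp add: power2_eq_square norm_F_minus_commute[of G' n n])
  also have "\<dots> \<le> l * a / c\<^sup>2"
    by (intro divide_right_mono G_close) simp
  finally have 1: "norm_F (R * (G' - G) * R') \<le> l / c\<^sup>2 * a" by simp
  have "norm_F (R * p.D * ?\<Delta> * (q.D * R')) \<le> (1 + g / c) * norm_F (R * p.D * ?\<Delta>)"
    by (intro norm_F_mult_le'[of _ n] q.DR_bound mult_carrier_mat[of _ n n]) auto
  also have "\<dots> \<le> (1 + g / c) * ((1 + g / c) * norm_F ?\<Delta>)"
    using p.c_pos p.g_nonneg by (intro mult_left_mono norm_F_mult_le[of n] p.RD_bound) auto
  also have "norm_F ?\<Delta> = vnorm (x - y)"
    using p.x_carrier q.x_carrier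
    by (auto simp: norm_F_mat_diag vnorm_eq_L2_set intro!: L2_set_cong)
  also have "(1 + g / c) * ((1 + g / c) * vnorm (x - y)) \<le> (1 + g / c) * ((1 + g / c) * a)"
    using p.c_pos p.g_nonneg by (intro mult_left_mono x_close) auto
  finally have 2: "norm_F (R * p.D * ?\<Delta> * (q.D * R')) \<le> (1 + g / c)\<^sup>2 * a"
    by (simp add: power2_eq_square mult.assoc)
  have "norm_F (R - R') \<le> norm_F (R * (G' - G) * R') + norm_F (R * p.D * ?\<Delta> * (q.D * R'))"
    unfolding resolvent_diff by (intro norm_F_add_le[of _ n n] mult_carrier_mat[of _ n n]) auto
  with 1 2 show ?thesis
    unfolding lip_R_def distrib_right by linarith
qed

lemma norm_F_RD_diff: "norm_F (R * p.D - R' * q.D) \<le> lip_RD c g l * a"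
proof -
  have "R * p.D - R' * q.D = R' * G' - R * G"
    unfolding p.RD_eq q.RD_eq 
    by (intro eq_matI) (auto simp del: index_mult_mat(1))
  then have "norm_F (R * p.D - R' * q.D) = norm_F (R * G - R' * G')"
    using norm_F_minus_commute[OF mult_carrier_mat[OF p.carriers(2,1)] mult_carrier_mat[OF q.carriers(2,1)]]
    by simp
  also have "\<dots> \<le> g * norm_F (R - R') + 1 / c * norm_F (G - G')"
    by (intro norm_F_mult_diff_le[of _ n] q.R_bound p.G_bound) auto
  also have "\<dots> \<le> g * (lip_R c g l * a) + 1 / c * (l * a)"
    using p.c_pos p.g_nonneg by (intro add_mono mult_left_mono norm_F_R_diff G_close) auto
  finally show ?thesis by (simp add: lip_RD_def algebra_simps)
qed

lemma norm_F_DR_diff: "norm_F (p.D * R - q.D * R') \<le> lip_RD c g l * a"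
proof -
  have "p.D * R - q.D * R' = G' * R' - G * R"
    unfolding p.DR_eq q.DR_eq 
    by (intro eq_matI) (auto simp del: index_mult_mat(1))
  then have "norm_F (p.D * R - q.D * R') = norm_F (G * R - G' * R')"
    using norm_F_minus_commute[OF mult_carrier_mat[OF p.carriers] mult_carrier_mat[OF q.carriers]]
    by simp
  also have "\<dots> \<le> 1 / c * norm_F (G - G') + g * norm_F (R - R')"
    by (intro norm_F_mult_diff_le[of _ n] p.R_bound q.G_bound) auto
  also have "\<dots> \<le> 1 / c * (l * a) + g * (lip_R c g l * a)"
    using p.c_pos p.g_nonneg by (intro add_mono mult_left_mono norm_F_R_diff G_close) auto
  finally show ?thesis by (simp add: lip_RD_def algebra_simps)
qed

lemma norm_F_square_diff: "norm_F (R * R - R' * R') \<le> 2 * lip_R c g l / c * a"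
proof -
  have "norm_F (R * R - R' * R') \<le> 1 / c * norm_F (R - R') + 1 / c * norm_F (R - R')"
    by (intro norm_F_mult_diff_le[of _ n] p.R_bound q.R_bound) auto
  also have "\<dots> \<le> 1 / c * (lip_R c g l * a) + 1 / c * (lip_R c g l * a)"
    using p.c_pos by (intro add_mono mult_left_mono norm_F_R_diff) auto
  finally show ?thesis by (simp add: mult_ac)
qed

lemma norm_F_defect_diff: "norm_F (defect \<beta> p.D R - defect \<beta> q.D R') \<le> lip_defect \<beta> c g l * a"
proof -
  let ?B = "1 + g / c"
  let ?X = "p.D * (R * R) * p.D" and ?X' = "q.D * (R' * R') * q.D"
  let ?\<tau> = "ntrace (R * R)" and ?\<tau>' = "ntrace (R' * R')"
  have [simp]: "R * R \<in> carrier_mat n n" "R' * R' \<in> carrier_mat n n"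
    "R * p.D \<in> carrier_mat n n" "R' * q.D \<in> carrier_mat n n"
    "p.D * R \<in> carrier_mat n n" "q.D * R' \<in> carrier_mat n n"
    "?X \<in> carrier_mat n n" "?X' \<in> carrier_mat n n"
    by (auto simp: square_carrier)
  have X: "?X = (p.D * R) * (R * p.D)" "?X' = (q.D * R') * (R' * q.D)"
    by (simp_all add: p.square_simps)
  have "norm_F (?X - ?X') \<le> ?B * norm_F (p.D * R - q.D * R') + ?B * norm_F (R * p.D - R' * q.D)"
    unfolding X by (intro norm_F_mult_diff_le[of _ n] p.RD_bound q.DR_bound) auto
  also have "\<dots> \<le> ?B * (lip_RD c g l * a) + ?B * (lip_RD c g l * a)"
    using p.c_pos p.g_nonneg by (intro add_mono mult_left_mono norm_F_RD_diff norm_F_DR_diff) auto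
  finally have 1: "norm_F (?X - ?X') \<le> 2 * ?B * lip_RD c g l * a"
    by (simp add: algebra_simps)
  have "\<beta>\<^sup>2 * (\<bar>?\<tau> - ?\<tau>'\<bar> * sqrt (real n)) \<le> \<beta>\<^sup>2 * norm_F (R * R - R' * R')"
    using abs_ntrace_le[of "R * R - R' * R'" n]
    by (intro mult_left_mono) (simp_all add: ntrace_diff[of _ n] square_carrier)
  also have "\<dots> \<le> \<beta>\<^sup>2 * (2 * lip_R c g l / c * a)"
    by (intro mult_left_mono norm_F_square_diff) simp
  finally have 2: "\<beta>\<^sup>2 * (\<bar>?\<tau> - ?\<tau>'\<bar> * sqrt (real n)) \<le> 2 * \<beta>\<^sup>2 * lip_R c g l / c * a"
    by (simp add: mult_ac)
  have "defect \<beta> p.D R - defect \<beta> q.D R' = diag_proj (?X - ?X') - (\<beta>\<^sup>2 * (?\<tau> - ?\<tau>')) \<cdot>\<^sub>m 1\<^sub>m n"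
    unfolding defect_def by (intro eq_matI) (auto simp: diag_proj_diff[of _ n] diag_proj_def algebra_simps)
  then have "norm_F (defect \<beta> p.D R - defect \<beta> q.D R')
      \<le> norm_F (diag_proj (?X - ?X')) + norm_F ((\<beta>\<^sup>2 * (?\<tau> - ?\<tau>')) \<cdot>\<^sub>m 1\<^sub>m n)"
    by (auto intro!: norm_F_diff_le[of _ n n] simp: square_carrier)
  also have "\<dots> \<le> norm_F (?X - ?X') + \<beta>\<^sup>2 * (\<bar>?\<tau> - ?\<tau>'\<bar> * sqrt (real n))"
    using norm_F_diag_proj_le[of "?X - ?X'" n]
    by (simp add: norm_F_smult norm_F_one abs_mult square_carrier)
  finally show ?thesis
    using 1 2 unfolding lip_defect_def distrib_right by linarith
qed

text \<open>
  A first-order expansion of \<open>Tr R - \<Sum> x\<^sub>i\<close>. The trace of the resolvent identity is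
  \<open>Tr(diag(x - y) D' R' R D)\<close> plus the contribution of the mean; replacing \<open>R'\<close> by \<open>R\<close> in both costs a
  quadratic error and leaves the pairing of \<open>x - y\<close> with the defect.
\<close>

lemma trace_taylor:
  assumes G: "G' - G = (\<beta>\<^sup>2 * ((\<Sum>i<n. y $ i - x $ i) / real n)) \<cdot>\<^sub>m 1\<^sub>m n"
  shows "\<bar>(mtrace R - (\<Sum>i<n. x $ i)) - (mtrace R' - (\<Sum>i<n. y $ i))\<bar>
    \<le> norm_F (defect \<beta> p.D R) * vnorm (x - y)
      + (\<beta>\<^sup>2 * lip_R c g l / c + (1 + g / c) * lip_RD c g l) * a\<^sup>2"
proof -
  let ?B = "1 + g / c"
  let ?Z = "defect \<beta> p.D R"
  let ?\<Delta> = "mat_diag n (\<lambda>i. x $ i - y $ i)"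
  define S where "S = (\<Sum>i<n. x $ i - y $ i)"
  define k where "k = \<beta>\<^sup>2 * ((\<Sum>i<n. y $ i - x $ i) / real n)"
  define U where "U = (q.D * R' - p.D * R) * (R * p.D)"
  have [simp]: "R * R \<in> carrier_mat n n" "R' * R' \<in> carrier_mat n n" "R * R' \<in> carrier_mat n n"
    "R * p.D \<in> carrier_mat n n" "R' * q.D \<in> carrier_mat n n"
    "p.D * R \<in> carrier_mat n n" "q.D * R' \<in> carrier_mat n n"
    "p.D * (R * R) * p.D \<in> carrier_mat n n"
    and U_carrier [simp]: "U \<in> carrier_mat n n"
    by (auto simp: square_carrier U_def)
  have norm_\<Delta>: "norm_F ?\<Delta> = vnorm (x - y)"
    using p.x_carrier q.x_carrier
    by (auto simp: norm_F_mat_diag vnorm_eq_L2_set intro!: L2_set_cong)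
  have "R * (G' - G) * R' = k \<cdot>\<^sub>m (R * R')"
    unfolding G k_def[symmetric]
    by (simp add: p.square_simps)
  then have "mtrace R - mtrace R' = k * mtrace (R * R') + mtrace (R * p.D * ?\<Delta> * (q.D * R'))"
    using resolvent_diff mtrace_diff[of R n R']
    by (simp add: mtrace_add[of _ n] mtrace_smult[of _ n] mult_carrier_mat[of _ n n])
  moreover have "mtrace (R * p.D * ?\<Delta> * (q.D * R')) = mtrace (?\<Delta> * ((q.D * R') * (R * p.D)))"
  proof -
    have "mtrace ((R * p.D) * (?\<Delta> * (q.D * R'))) = mtrace ((?\<Delta> * (q.D * R')) * (R * p.D))"
      by (intro mtrace_comm[of _ n]) (auto intro: mult_carrier_mat[of _ n n])
    then show ?thesis
      by (simp add: p.square_simps del: mat_diag_diag)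
  qed
  moreover have "(q.D * R') * (R * p.D) = U + p.D * (R * R) * p.D"
  proof -
    have "U = (q.D * R') * (R * p.D) - (p.D * R) * (R * p.D)"
      unfolding U_def by (intro minus_mult_distrib_mat[of _ n n]) auto
    moreover have "(p.D * R) * (R * p.D) = p.D * (R * R) * p.D"
      by (simp add: p.square_simps)
    ultimately show ?thesis
      by (intro eq_matI) auto
  qed
  moreover have "mtrace (?\<Delta> * (U + p.D * (R * R) * p.D))
      = mtrace (?\<Delta> * U) + (mtrace (?\<Delta> * ?Z) + (1 + \<beta>\<^sup>2 * ntrace (R * R)) * S)"
  proof -
    have "mtrace (?\<Delta> * (p.D * (R * R) * p.D)) - mtrace (?\<Delta> * ?Z) = (1 + \<beta>\<^sup>2 * ntrace (R * R)) * S"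
      unfolding S_def sum_distrib_left
      by (simp add: mtrace_mat_diag_mult flip: sum_subtractf)
         (auto simp: defect_def diag_proj_def algebra_simps intro!: sum.cong)
    moreover have "mtrace (?\<Delta> * (U + p.D * (R * R) * p.D)) 
        = mtrace (?\<Delta> * U) + mtrace (?\<Delta> * (p.D * (R * R) * p.D))"
      by (simp add: mtrace_mat_diag_mult distrib_left flip: sum.distrib)
    ultimately show ?thesis by simp
  qed
  moreover have "k * mtrace (R * R') = k * mtrace (R * (R' - R)) - \<beta>\<^sup>2 * ntrace (R * R) * S"
  proof -
    have "k * mtrace (R * R) = - (\<beta>\<^sup>2 * ntrace (R * R) * S)"
    proof -
      have "(\<Sum>i<n. y $ i - x $ i) = - S"
        by (simp add: S_def sum_subtractf)
      then show ?thesis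
        by (simp add: k_def ntrace_def)
    qed
    moreover have "mtrace (R * (R' - R)) = mtrace (R * R') - mtrace (R * R)"
      by (simp add: p.square_simps mtrace_diff[of _ n])
    ultimately show ?thesis by (simp add: right_diff_distrib)
  qed
  moreover have "S = (\<Sum>i<n. x $ i) - (\<Sum>i<n. y $ i)"
    by (simp add: S_def sum_subtractf)
  ultimately have "(mtrace R - (\<Sum>i<n. x $ i)) - (mtrace R' - (\<Sum>i<n. y $ i))
      = mtrace (?\<Delta> * ?Z) + k * mtrace (R * (R' - R)) + mtrace (?\<Delta> * U)"
    by (simp add: algebra_simps)
  moreover have "\<bar>mtrace (?\<Delta> * ?Z)\<bar> \<le> norm_F ?Z * vnorm (x - y)"
    using abs_mtrace_mult_le[of ?\<Delta> n ?Z] by (simp add: norm_\<Delta> mult.commute)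
  moreover have "\<bar>k * mtrace (R * (R' - R))\<bar> \<le> \<beta>\<^sup>2 * lip_R c g l / c * a\<^sup>2"
  proof -
    have "\<beta>\<^sup>2 * (\<bar>(\<Sum>i<n. y $ i - x $ i) / real n\<bar> * sqrt (real n)) \<le> \<beta>\<^sup>2 * a"
      using abs_mean_diff_le[OF q.x_carrier p.x_carrier] x_close p.x_carrier q.x_carrier
      by (intro mult_left_mono) (auto simp: vnorm_minus_commute[of y n x])
    then have "\<bar>k\<bar> * sqrt (real n) \<le> \<beta>\<^sup>2 * a"
      by (simp only: k_def abs_mult mult.assoc) simp
    note k_le = this
    have "\<bar>mtrace (R * (R' - R))\<bar> \<le> sqrt (real n) / c * (lip_R c g l * a)"
    proof -
      have "\<bar>mtrace (R * (R' - R))\<bar> \<le> norm_F R * norm_F (R' - R)"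
        by (intro abs_mtrace_mult_le[of _ n]) auto
      also have "\<dots> \<le> sqrt (real n) / c * (lip_R c g l * a)"
        using norm_F_R_diff p.norm_F_R p.c_pos
        by (intro mult_mono) (auto simp: norm_F_minus_commute[of R' n n])
      finally show ?thesis .
    qed
    then have "\<bar>k\<bar> * \<bar>mtrace (R * (R' - R))\<bar> \<le> \<bar>k\<bar> * (sqrt (real n) / c * (lip_R c g l * a))"
      by (intro mult_left_mono) auto
    also have "\<dots> = (\<bar>k\<bar> * sqrt (real n)) * (lip_R c g l * a / c)" by simp
    also have "\<dots> \<le> (\<beta>\<^sup>2 * a) * (lip_R c g l * a / c)"
      using k_le norm_F_R_diff norm_F_nonneg[of "R - R'"] p.c_pos
      by (intro mult_right_mono divide_nonneg_pos) linarith+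
    finally show ?thesis by (simp add: abs_mult power2_eq_square mult_ac)
  qed
  moreover have "\<bar>mtrace (?\<Delta> * U)\<bar> \<le> ?B * lip_RD c g l * a\<^sup>2"
  proof -
    have "norm_F U \<le> ?B * norm_F (q.D * R' - p.D * R)"
      unfolding U_def by (intro norm_F_mult_le'[of _ n] p.RD_bound) auto
    also have "\<dots> \<le> ?B * (lip_RD c g l * a)"
      using norm_F_DR_diff p.c_pos p.g_nonneg
      by (intro mult_left_mono) (auto simp: norm_F_minus_commute[of "q.D * R'" n n])
    finally have "vnorm (x - y) * norm_F U \<le> a * (?B * (lip_RD c g l * a))"
      using x_close a_nonneg by (intro mult_mono) auto
    then show ?thesis
      using abs_mtrace_mult_le[of ?\<Delta> n U] by (simp add: norm_\<Delta> power2_eq_square mult_ac)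
  qed
  ultimately show ?thesis
    unfolding distrib_right by linarith
qed

end

section \<open>The TAP Hessian as a resolvent\<close>

text \<open>
  The part of \<open>Y\<close> other than \<open>D\<close>. The scalar \<open>1 - \<parallel>m\<parallel>\<^sup>2/n\<close> in the Hessian is the mean of \<open>x\<close>, and
  so is \<open>tr\<^sub>n(D\<^sup>-\<^sup>1)\<close>, so both the Hessian and the matrices in \<open>\<Omega>\<close> are expressed through \<open>x\<close>.
\<close>

definition base_mat :: "real \<Rightarrow> real mat \<Rightarrow> real vec \<Rightarrow> real mat" where
  "base_mat \<beta> A x = (\<beta>\<^sup>2 * ((\<Sum>i<dim_vec x. x $ i) / real (dim_vec x))) \<cdot>\<^sub>m 1\<^sub>m (dim_vec x) - \<beta> \<cdot>\<^sub>m A"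

definition inv_diag :: "real vec \<Rightarrow> real mat" where
  "inv_diag x = mat_diag (dim_vec x) (\<lambda>i. 1 / x $ i)"

definition Y_of :: "real \<Rightarrow> real mat \<Rightarrow> real vec \<Rightarrow> real mat" where
  "Y_of \<beta> A x = base_mat \<beta> A x + inv_diag x"

definition R_of :: "real \<Rightarrow> real mat \<Rightarrow> real vec \<Rightarrow> real mat" where
  "R_of \<beta> A x = minv (Y_of \<beta> A x)"

text \<open>
  The set \<open>S\<^sub>D\<close> in the coordinates \<open>x\<^sub>i = 1/D\<^sub>i\<close>, in which neither the diagonal nor the traces
  are singular.
\<close>

definition admissible :: "real \<Rightarrow> real mat \<Rightarrow> real \<Rightarrow> nat \<Rightarrow> real vec set" where
  "admissible \<beta> A c n = {x \<in> carrier_vec n. (\<forall>i<n. 0 < x $ i \<and> x $ i \<le> 1) \<and>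
     (\<forall>v\<in>carrier_vec n. c * (vnorm v)\<^sup>2 \<le> v \<bullet> (Y_of \<beta> A x *\<^sub>v v))}"

definition one_minus_sq :: "real vec \<Rightarrow> real vec" where
  "one_minus_sq m = vec (dim_vec m) (\<lambda>i. 1 - (m $ i)\<^sup>2)"

text \<open>
  The rank-one term that is subtracted from \<open>Y\<close> in the Hessian.
\<close>

definition rank1 :: "real \<Rightarrow> real vec \<Rightarrow> real mat" where
  "rank1 \<beta> m = (2 * \<beta>\<^sup>2 / real (dim_vec m)) \<cdot>\<^sub>m outer m m"

lemma pow_mat_2: "X \<in> carrier_mat n n \<Longrightarrow> X ^\<^sub>m 2 = X * X"
  by (simp add: numeral_2_eq_2)

lemma minv_mat_diag:
  fixes x :: "real vec"
  assumes "\<And>i. i < n \<Longrightarrow> x $ i \<noteq> 0"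
  shows "minv (mat_diag n (\<lambda>i. 1 / x $ i)) = mat_diag n (\<lambda>i. x $ i)"
proof (rule minv_eqI[of _ n])
  show "mat_diag n (\<lambda>i. 1 / x $ i) * mat_diag n (\<lambda>i. x $ i) = 1\<^sub>m n"
    using assms by (simp only: mat_diag_diag) (intro eq_matI, auto simp: mat_diag_def)
qed auto

lemma mat_diag_mult_vec:
  assumes "v \<in> carrier_vec n"
  shows "mat_diag n f *\<^sub>v v = vec n (\<lambda>i. f i * v $ i)"
  using assms
  by (intro eq_vecI) (auto simp: mat_diag_def scalar_prod_def if_distrib[of "\<lambda>x. x * _"] cong: if_cong)

lemma scalar_prod_mat_diag:
  fixes v :: "real vec"
  assumes "v \<in> carrier_vec n"
  shows "v \<bullet> (mat_diag n f *\<^sub>v v) = (\<Sum>i<n. f i * (v $ i)\<^sup>2)"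
proof -
  have "v $ i * (f i * v $ i) = f i * (v $ i)\<^sup>2" for i
    by (simp only: power2_eq_square mult_ac)
  moreover have "v \<bullet> (mat_diag n f *\<^sub>v v) = (\<Sum>i<n. v $ i * (f i * v $ i))"
    using assms by (simp add: mat_diag_mult_vec) (simp add: scalar_prod_def atLeast0LessThan)
  ultimately show ?thesis
    by (simp only:)
qed

lemma outer_carrier [simp]:
  "u \<in> carrier_vec n \<Longrightarrow> v \<in> carrier_vec m \<Longrightarrow> outer u v \<in> carrier_mat n m"
  by (simp add: outer_def)

lemma outer_mult_vec:
  assumes "u \<in> carrier_vec n" "v \<in> carrier_vec m" "w \<in> carrier_vec m"
  shows "outer u v *\<^sub>v w = (v \<bullet> w) \<cdot>\<^sub>v u"
  using assms by (intro eq_vecI) (auto simp: outer_def scalar_prod_def sum_distrib_left mult_ac)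

lemma outer_diff:
  assumes "m \<in> carrier_vec n" "w \<in> carrier_vec n"
  shows "outer m m - outer w w = outer (m - w) m + outer w (m - w)"
  using assms by (intro eq_matI) (auto simp: outer_def algebra_simps)

lemma norm_F_outer_diff_le:
  assumes m: "m \<in> carrier_vec n" and w: "w \<in> carrier_vec n"
  shows "norm_F (outer m m - outer w w) \<le> (vnorm m + vnorm w) * vnorm (m - w)"
proof -
  have "norm_F (outer m m - outer w w) \<le> norm_F (outer (m - w) m) + norm_F (outer w (m - w))"
    unfolding outer_diff[OF m w] using m w by (intro norm_F_add_le[of _ n n]) auto
  also have "\<dots> = (vnorm m + vnorm w) * vnorm (m - w)"
    using norm_F_outer[of "m - w" n m] norm_F_outer[of w n "m - w"] m w by (simp add: algebra_simps)
  finally show ?thesis .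
qed

lemma add_mult_vec:
  fixes X Y :: "real mat"
  shows "X \<in> carrier_mat n n \<Longrightarrow> Y \<in> carrier_mat n n \<Longrightarrow> v \<in> carrier_vec n \<Longrightarrow>
    v \<bullet> ((X + Y) *\<^sub>v v) = v \<bullet> (X *\<^sub>v v) + v \<bullet> (Y *\<^sub>v v)"
  by (simp add: add_mult_distrib_mat_vec[of _ n n] scalar_prod_add_distrib[of _ n])

lemma diff_mult_vec:
  fixes X Y :: "real mat"
  shows "X \<in> carrier_mat n n \<Longrightarrow> Y \<in> carrier_mat n n \<Longrightarrow> v \<in> carrier_vec n \<Longrightarrow>
    v \<bullet> ((X - Y) *\<^sub>v v) = v \<bullet> (X *\<^sub>v v) - v \<bullet> (Y *\<^sub>v v)"
  by (simp add: minus_mult_distrib_mat_vec[of _ n n] scalar_prod_minus_distrib[of _ n])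

lemma smult_mult_vec:
  fixes X :: "real mat"
  shows "X \<in> carrier_mat n n \<Longrightarrow> v \<in> carrier_vec n \<Longrightarrow> v \<bullet> ((a \<cdot>\<^sub>m X) *\<^sub>v v) = a * (v \<bullet> (X *\<^sub>v v))"
proof -
  assume X: "X \<in> carrier_mat n n" and v: "v \<in> carrier_vec n"
  have "(a \<cdot>\<^sub>m X) *\<^sub>v v = a \<cdot>\<^sub>v (X *\<^sub>v v)"
    using X v by (intro eq_vecI) auto
  then show ?thesis using X v by (simp add: scalar_prod_smult_distrib[of _ n])
qed

text \<open>
  The hypotheses on \<open>A\<close> that do not involve \<open>\<Omega>\<close>.
\<close>

locale tap =
  fixes \<beta> c :: real and n :: nat and A :: "real mat"
  assumes \<beta>_pos: "0 < \<beta>" and \<beta>_less_1: "\<beta> < 1" and c_pos: "0 < c" and n_pos: "0 < n"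
    and A_carrier: "A \<in> carrier_mat n n" and A_sym: "transpose_mat A = A" and A_norm: "norm_op A \<le> 3"
begin

text \<open>
  Common constants for the two families of resolvents: \<open>g\<close> bounds the operator norm of the
  bounded part of \<open>Y\<close> and of the Hessian (\<open>\<beta>\<^sup>2\<close> from the mean, \<open>3\<beta>\<close> from \<open>A\<close>, \<open>2\<beta>\<^sup>2\<close> from the rank-one
  term), and \<open>l\<close> bounds its variation relative to the distance \<open>a\<close> of \<open>resolvent_pair\<close>.
\<close>

abbreviation "g \<equiv> 3 * \<beta>\<^sup>2 + 3 * \<beta>"
abbreviation "l \<equiv> 3 * \<beta>\<^sup>2"

lemma base_carrier: "x \<in> carrier_vec n \<Longrightarrow> base_mat \<beta> A x \<in> carrier_mat n n"
  using A_carrier by (simp add: base_mat_def minus_carrier_mat)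

lemma inv_diag_carrier: "x \<in> carrier_vec n \<Longrightarrow> inv_diag x \<in> carrier_mat n n"
  by (simp add: inv_diag_def)

lemma inv_diag_eq: "x \<in> carrier_vec n \<Longrightarrow> inv_diag x = mat_diag n (\<lambda>i. 1 / x $ i)"
  by (simp add: inv_diag_def)

lemma Y_carrier: "x \<in> carrier_vec n \<Longrightarrow> Y_of \<beta> A x \<in> carrier_mat n n"
  by (simp add: Y_of_def inv_diag_carrier)

lemma Y_sym: "x \<in> carrier_vec n \<Longrightarrow> transpose_mat (Y_of \<beta> A x) = Y_of \<beta> A x"
proof -
  assume x: "x \<in> carrier_vec n"
  have "A $$ (j, i) = A $$ (i, j)" if "i < n" "j < n" for i j
    using arg_cong[OF A_sym, of "\<lambda>M. M $$ (i, j)"] A_carrier that by simp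
  then show ?thesis
    using x A_carrier
    by (intro eq_matI) (auto simp: Y_of_def base_mat_def inv_diag_def mat_diag_def)
qed

lemma base_bound:
  assumes x: "x \<in> carrier_vec n" and "\<And>i. i < n \<Longrightarrow> 0 < x $ i \<and> x $ i \<le> 1"
  shows "op_bound n (\<beta>\<^sup>2 + 3 * \<beta>) (base_mat \<beta> A x)"
proof -
  let ?k = "(\<Sum>i<n. x $ i) / real n"
  have "0 \<le> (\<Sum>i<n. x $ i)" using assms(2) by (intro sum_nonneg) (auto simp: less_imp_le)
  moreover have "(\<Sum>i<n. x $ i) \<le> real n"
    using sum_mono[of "{..<n}" "\<lambda>i. x $ i" "\<lambda>_. 1"] assms(2) by simp
  ultimately have k: "0 \<le> ?k" "?k \<le> 1" using n_pos by auto
  have "op_bound n (\<bar>\<beta>\<^sup>2 * ?k\<bar> * 1 + \<bar>\<beta>\<bar> * 3) (base_mat \<beta> A x)"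
  proof -
    have "op_bound n (\<bar>\<beta>\<^sup>2 * ?k\<bar> * 1 + \<bar>\<beta>\<bar> * 3) ((\<beta>\<^sup>2 * ?k) \<cdot>\<^sub>m 1\<^sub>m n - \<beta> \<cdot>\<^sub>m A)"
      using A_carrier A_norm
      by (intro op_bound_diff op_bound_smult op_bound_one op_bound_norm_op) auto
    then show ?thesis
      using x by (simp add: base_mat_def)
  qed
  moreover have "\<bar>\<beta>\<^sup>2 * ?k\<bar> * 1 + \<bar>\<beta>\<bar> * 3 \<le> \<beta>\<^sup>2 + 3 * \<beta>"
    using mult_left_le[OF k(2) zero_le_power2, of \<beta>] abs_of_nonneg[OF mult_nonneg_nonneg[OF zero_le_power2 k(1)], of \<beta>] \<beta>_pos
    by linarith
  ultimately show ?thesis by (rule op_bound_mono)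
qed

lemma base_diff:
  assumes "x \<in> carrier_vec n" "y \<in> carrier_vec n"
  shows "base_mat \<beta> A x - base_mat \<beta> A y = (\<beta>\<^sup>2 * ((\<Sum>i<n. x $ i - y $ i) / real n)) \<cdot>\<^sub>m 1\<^sub>m n"
  using assms A_carrier
  by (intro eq_matI) (auto simp: base_mat_def sum_subtractf diff_divide_distrib algebra_simps)

lemma norm_F_base_diff:
  assumes "x \<in> carrier_vec n" "y \<in> carrier_vec n"
  shows "norm_F (base_mat \<beta> A x - base_mat \<beta> A y) \<le> \<beta>\<^sup>2 * vnorm (x - y)"
  using mult_left_mono[OF abs_mean_diff_le[OF assms], of "\<beta>\<^sup>2"]
  by (simp add: base_diff[OF assms] norm_F_smult norm_F_one abs_mult)

lemma admissibleD:
  assumes "x \<in> admissible \<beta> A c n"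
  shows "x \<in> carrier_vec n" "\<And>i. i < n \<Longrightarrow> 0 < x $ i" "\<And>i. i < n \<Longrightarrow> x $ i \<le> 1"
    "\<And>v. v \<in> carrier_vec n \<Longrightarrow> c * (vnorm v)\<^sup>2 \<le> v \<bullet> (Y_of \<beta> A x *\<^sub>v v)"
  using assms by (auto simp: admissible_def)

lemma resolvent_R:
  assumes x: "x \<in> admissible \<beta> A c n"
  shows "resolvent n c g x (base_mat \<beta> A x) (R_of \<beta> A x)"
proof -
  note a = admissibleD[OF x]
  note inv = minv_inverse[OF Y_carrier[OF a(1)] c_pos a(4)]
  show ?thesis
    using inv a(1-3) c_pos op_bound_mono[OF base_bound[OF a(1)], of g]
    by unfold_locales (auto simp: R_of_def Y_of_def inv_diag_eq)
qed

lemma R_carrier: "x \<in> admissible \<beta> A c n \<Longrightarrow> R_of \<beta> A x \<in> carrier_mat n n"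
  using resolvent.carriers(2)[OF resolvent_R] .

lemma R_sym:
  assumes x: "x \<in> admissible \<beta> A c n"
  shows "transpose_mat (R_of \<beta> A x) = R_of \<beta> A x"
  using minv_transpose[OF Y_carrier Y_sym] minv_inverse(1)[OF Y_carrier c_pos admissibleD(4)[OF x]]
    admissibleD(1)[OF x] R_carrier[OF x] by (simp add: R_of_def)

lemma pair_RR:
  assumes x: "x \<in> admissible \<beta> A c n" and y: "y \<in> admissible \<beta> A c n" and a: "vnorm (x - y) \<le> a"
  shows "resolvent_pair n c g x (base_mat \<beta> A x) (R_of \<beta> A x) y (base_mat \<beta> A y) (R_of \<beta> A y) a l"
proof -
  have "norm_F (base_mat \<beta> A x - base_mat \<beta> A y) \<le> \<beta>\<^sup>2 * vnorm (x - y)"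
    using admissibleD(1)[OF x] admissibleD(1)[OF y] by (rule norm_F_base_diff)
  also have "\<dots> \<le> l * a"
    using a vnorm_nonneg[of "x - y"] by (intro mult_mono) auto
  finally show ?thesis
    using resolvent_R[OF x] resolvent_R[OF y] a
    by (simp add: resolvent_pair_def resolvent_pair_axioms_def)
qed

lemma open_cubeD:
  assumes "m \<in> open_cube n"
  shows "m \<in> carrier_vec n" "\<And>i. i < n \<Longrightarrow> \<bar>m $ i\<bar> < 1"
  using assms by (auto simp: open_cube_def abs_less_iff)

lemma vnorm_cube: "m \<in> open_cube n \<Longrightarrow> vnorm m \<le> sqrt (real n)"
  using open_cubeD[of m] by (intro vnorm_le_sqrt_dim) (auto simp: less_imp_le)

lemma one_minus_sq_carrier: "m \<in> carrier_vec n \<Longrightarrow> one_minus_sq m \<in> carrier_vec n"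
  by (simp add: one_minus_sq_def)

lemma one_minus_sq_range:
  assumes "m \<in> open_cube n" "i < n"
  shows "0 < one_minus_sq m $ i" "one_minus_sq m $ i \<le> 1"
  using open_cubeD[OF assms(1)] assms(2) by (auto simp: one_minus_sq_def abs_square_less_1)

lemma rank1_carrier: "m \<in> carrier_vec n \<Longrightarrow> rank1 \<beta> m \<in> carrier_mat n n"
  by (simp add: rank1_def)

lemma hess_eq:
  assumes "m \<in> carrier_vec n"
  shows "hess_TAP \<beta> A m = (base_mat \<beta> A (one_minus_sq m) - rank1 \<beta> m) + inv_diag (one_minus_sq m)"
    "hess_TAP \<beta> A m = Y_of \<beta> A (one_minus_sq m) - rank1 \<beta> m"
proof -
  have "(\<Sum>i<n. 1 - (m $ i)\<^sup>2) / real n = 1 - (vnorm m)\<^sup>2 / real n"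
    using assms n_pos by (simp add: sum_subtractf vnorm_square_sum diff_divide_distrib)
  then have mean: "(\<Sum>i<n. one_minus_sq m $ i) / real n = 1 - (vnorm m)\<^sup>2 / real n"
    using assms by (simp add: one_minus_sq_def)
  have dim [simp]: "dim_vec (one_minus_sq m) = n" "dim_vec m = n"
    using assms by (simp_all add: one_minus_sq_def)
  show "hess_TAP \<beta> A m = (base_mat \<beta> A (one_minus_sq m) - rank1 \<beta> m) + inv_diag (one_minus_sq m)"
    "hess_TAP \<beta> A m = Y_of \<beta> A (one_minus_sq m) - rank1 \<beta> m"
    unfolding hess_TAP_def Let_def base_mat_def Y_of_def dim mean using A_carrier
    by (auto intro!: eq_matI
        simp: rank1_def D_mat_def inv_diag_def mat_diag_def one_minus_sq_def outer_def)
qed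

lemma rank1_bound:
  assumes m: "m \<in> open_cube n"
  shows "norm_F (rank1 \<beta> m) \<le> 2 * \<beta>\<^sup>2"
proof -
  have "vnorm m * vnorm m \<le> sqrt (real n) * sqrt (real n)"
    using vnorm_cube[OF m] by (intro mult_mono) auto
  then have "2 * \<beta>\<^sup>2 * (vnorm m * vnorm m) \<le> 2 * \<beta>\<^sup>2 * real n"
    by (intro mult_left_mono) auto
  then show ?thesis
    using open_cubeD(1)[OF m] n_pos
    by (simp add: rank1_def norm_F_smult norm_F_outer pos_divide_le_eq)
qed

lemma rank1_diff:
  assumes m: "m \<in> open_cube n" and w: "w \<in> open_cube n"
  shows "norm_F (rank1 \<beta> m - rank1 \<beta> w) \<le> 4 * \<beta>\<^sup>2 * vnorm (m - w) / sqrt (real n)"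
proof -
  have mw: "m \<in> carrier_vec n" "w \<in> carrier_vec n"
    using open_cubeD(1) m w by auto
  have "rank1 \<beta> m - rank1 \<beta> w = (2 * \<beta>\<^sup>2 / real n) \<cdot>\<^sub>m (outer m m - outer w w)"
    using mw by (intro eq_matI) (auto simp: rank1_def outer_def algebra_simps)
  then have "norm_F (rank1 \<beta> m - rank1 \<beta> w) = 2 * \<beta>\<^sup>2 / real n * norm_F (outer m m - outer w w)"
    by (simp add: norm_F_smult)
  also have "\<dots> \<le> 2 * \<beta>\<^sup>2 / real n * ((vnorm m + vnorm w) * vnorm (m - w))"
    using norm_F_outer_diff_le[OF mw] by (intro mult_left_mono) auto
  also have "\<dots> \<le> 2 * \<beta>\<^sup>2 / real n * ((sqrt (real n) + sqrt (real n)) * vnorm (m - w))"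
    using vnorm_cube[OF m] vnorm_cube[OF w] by (intro mult_left_mono mult_right_mono add_mono) auto
  also have "\<dots> = 4 * \<beta>\<^sup>2 * vnorm (m - w) / sqrt (real n)"
    using n_pos by (simp add: field_simps)
  finally show ?thesis .
qed

lemma one_minus_sq_diff:
  assumes m: "m \<in> open_cube n" and w: "w \<in> open_cube n"
  shows "vnorm (one_minus_sq m - one_minus_sq w) \<le> 2 * vnorm (m - w)"
proof -
  have mw: "m \<in> carrier_vec n" "w \<in> carrier_vec n"
    using open_cubeD(1) m w by auto
  have "\<bar>(one_minus_sq m - one_minus_sq w) $ i\<bar> \<le> \<bar>(2 \<cdot>\<^sub>v (m - w)) $ i\<bar>" if "i < n" for i
  proof -
    have "\<bar>(m $ i + w $ i) * (w $ i - m $ i)\<bar> \<le> 2 * \<bar>w $ i - m $ i\<bar>"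
      unfolding abs_mult using open_cubeD(2)[OF m that] open_cubeD(2)[OF w that]
      by (intro mult_right_mono) auto
    moreover have "(one_minus_sq m - one_minus_sq w) $ i = (m $ i + w $ i) * (w $ i - m $ i)"
      using that mw by (simp add: one_minus_sq_def algebra_simps power2_eq_square)
    moreover have "\<bar>(2 \<cdot>\<^sub>v (m - w)) $ i\<bar> = 2 * \<bar>w $ i - m $ i\<bar>"
      using that mw by (simp add: abs_if)
    ultimately show ?thesis by simp
  qed
  then have "vnorm (one_minus_sq m - one_minus_sq w) \<le> vnorm (2 \<cdot>\<^sub>v (m - w))"
    using mw one_minus_sq_carrier by (intro vnorm_mono[of _ n]) auto
  then show ?thesis by (simp add: vnorm_smult)
qed

text \<open>
  \<open>D(m) \<ge> I\<close> turns the lower bound \<open>c D(m)\<close> into \<open>c I\<close>.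
\<close>

lemma S_domD:
  assumes m: "m \<in> S_dom \<beta> n A c"
  shows "m \<in> open_cube n"
    and S_dom_coercive: "\<And>v. v \<in> carrier_vec n \<Longrightarrow> c * (vnorm v)\<^sup>2 \<le> v \<bullet> (hess_TAP \<beta> A m *\<^sub>v v)"
proof -
  show m': "m \<in> open_cube n" using m by (simp add: S_dom_def)
  note mc = open_cubeD(1)[OF m']
  fix v :: "real vec" assume v: "v \<in> carrier_vec n"
  have D: "D_mat m = mat_diag n (\<lambda>i. 1 / (1 - (m $ i)\<^sup>2))"
    using mc by (simp add: D_mat_def)
  have H: "hess_TAP \<beta> A m \<in> carrier_mat n n"
    using mc by (simp add: hess_eq(1) inv_diag_carrier one_minus_sq_carrier)
  have "0 \<le> v \<bullet> ((hess_TAP \<beta> A m - c \<cdot>\<^sub>m D_mat m) *\<^sub>v v)"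
  proof (cases "v = 0\<^sub>v n")
    case True
    then show ?thesis
      using H D by (simp add: scalar_prod_left_zero[OF mult_mat_vec_carrier[of _ n n]] minus_carrier_mat)
  next
    case False
    then show ?thesis
      using m v by (force simp: S_dom_def loewner_less_def pos_def_def)
  qed
  then have "c * (v \<bullet> (D_mat m *\<^sub>v v)) \<le> v \<bullet> (hess_TAP \<beta> A m *\<^sub>v v)"
    using H v D by (simp add: diff_mult_vec[of _ n] smult_mult_vec[of _ n])
  moreover have "(vnorm v)\<^sup>2 \<le> v \<bullet> (D_mat m *\<^sub>v v)"
  proof -
    have "1 * (v $ i)\<^sup>2 \<le> 1 / (1 - (m $ i)\<^sup>2) * (v $ i)\<^sup>2" if "i < n" for i
      using open_cubeD(2)[OF m' that] by (intro mult_right_mono) (auto simp: abs_square_less_1)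
    then have "(\<Sum>i<n. (v $ i)\<^sup>2) \<le> (\<Sum>i<n. 1 / (1 - (m $ i)\<^sup>2) * (v $ i)\<^sup>2)"
      by (intro sum_mono) auto
    then show ?thesis
      using v by (simp add: D scalar_prod_mat_diag vnorm_square_sum)
  qed
  then have "c * (vnorm v)\<^sup>2 \<le> c * (v \<bullet> (D_mat m *\<^sub>v v))"
    using c_pos by (intro mult_left_mono) auto
  ultimately show "c * (vnorm v)\<^sup>2 \<le> v \<bullet> (hess_TAP \<beta> A m *\<^sub>v v)"
    by linarith
qed

text \<open>
  \<open>Y\<close> exceeds the Hessian by the rank-one term, which is positive semidefinite.
\<close>

lemma one_minus_sq_admissible:
  assumes m: "m \<in> S_dom \<beta> n A c"
  shows "one_minus_sq m \<in> admissible \<beta> A c n"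
proof -
  note m' = S_domD(1)[OF m]
  note mc = open_cubeD(1)[OF m']
  have "c * (vnorm v)\<^sup>2 \<le> v \<bullet> (Y_of \<beta> A (one_minus_sq m) *\<^sub>v v)" if v: "v \<in> carrier_vec n" for v
  proof -
    have "v \<bullet> (rank1 \<beta> m *\<^sub>v v) = 2 * \<beta>\<^sup>2 / real n * ((m \<bullet> v) * (v \<bullet> m))"
      unfolding rank1_def using mc v
      by (simp add: smult_mult_vec[of _ n] outer_mult_vec[of _ n _ n] scalar_prod_smult_distrib[of _ n])
    also have "(m \<bullet> v) * (v \<bullet> m) = (m \<bullet> v)\<^sup>2"
      using mc v by (simp add: power2_eq_square comm_scalar_prod[of v n m])
    finally have "0 \<le> v \<bullet> (rank1 \<beta> m *\<^sub>v v)" by simp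
    then show ?thesis
      using S_dom_coercive[OF m v] mc v
      by (simp add: hess_eq(2) diff_mult_vec[of _ n] Y_carrier one_minus_sq_carrier rank1_carrier)
  qed
  then show ?thesis
    using m' mc one_minus_sq_range by (auto simp: admissible_def one_minus_sq_carrier)
qed

lemma resolvent_Q:
  assumes m: "m \<in> S_dom \<beta> n A c"
  shows "resolvent n c g (one_minus_sq m) (base_mat \<beta> A (one_minus_sq m) - rank1 \<beta> m) (Q_hat \<beta> A m)"
proof -
  note m' = S_domD(1)[OF m]
  note mc = open_cubeD(1)[OF m']
  let ?x = "one_minus_sq m"
  note a = admissibleD[OF one_minus_sq_admissible[OF m]]
  have H: "hess_TAP \<beta> A m \<in> carrier_mat n n"
    using mc by (simp add: hess_eq(1) inv_diag_carrier one_minus_sq_carrier)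
  note inv = minv_inverse[OF H c_pos S_dom_coercive[OF m]]
  have "op_bound n (\<beta>\<^sup>2 + 3 * \<beta> + 2 * \<beta>\<^sup>2) (base_mat \<beta> A ?x - rank1 \<beta> m)"
    using a(1-3) op_bound_norm_F[OF rank1_carrier[OF mc]] rank1_bound[OF m']
    by (intro op_bound_diff base_bound) (auto intro: op_bound_mono)
  then have "op_bound n g (base_mat \<beta> A ?x - rank1 \<beta> m)" by (simp add: add.commute)
  then show ?thesis
    using inv a(1-3) c_pos
    by unfold_locales (auto simp: Q_hat_def hess_eq(1)[OF mc] inv_diag_eq)
qed

text \<open>
  The rank-one term has Frobenius norm at most \<open>2\<beta>\<^sup>2\<close>, so passing from \<open>Y\<close> to the Hessian is a
  perturbation at distance \<open>a = 1\<close> without moving \<open>x\<close>.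
\<close>

lemma pair_QR:
  assumes m: "m \<in> S_dom \<beta> n A c"
  shows "resolvent_pair n c g (one_minus_sq m) (base_mat \<beta> A (one_minus_sq m) - rank1 \<beta> m) (Q_hat \<beta> A m)
    (one_minus_sq m) (base_mat \<beta> A (one_minus_sq m)) (R_of \<beta> A (one_minus_sq m)) 1 l"
proof -
  note m' = S_domD(1)[OF m]
  note mc = open_cubeD(1)[OF m']
  note xc = one_minus_sq_carrier[OF mc]
  let ?B = "base_mat \<beta> A (one_minus_sq m)"
  have "?B - rank1 \<beta> m - ?B = (-1) \<cdot>\<^sub>m rank1 \<beta> m"
    using base_carrier[OF xc] rank1_carrier[OF mc] by (intro eq_matI) auto
  then have "norm_F (?B - rank1 \<beta> m - ?B) \<le> l * 1"
    using order_trans[OF rank1_bound[OF m'], of "l * 1"] by (simp add: norm_F_smult)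
  moreover have "vnorm (one_minus_sq m - one_minus_sq m) \<le> 1"
    using xc by (simp add: minus_cancel_vec)
  ultimately show ?thesis
    using resolvent_Q[OF m] resolvent_R[OF one_minus_sq_admissible[OF m]]
    by (simp add: resolvent_pair_def resolvent_pair_axioms_def)
qed

text \<open>
  The distance is \<open>2 \<parallel>m - w\<parallel>\<close> because \<open>m \<mapsto> 1 - m\<^sup>2\<close> has Lipschitz constant \<open>2\<close> on the cube.
\<close>

lemma pair_QQ:
  assumes m: "m \<in> S_dom \<beta> n A c" and w: "w \<in> S_dom \<beta> n A c"
  shows "resolvent_pair n c g (one_minus_sq m) (base_mat \<beta> A (one_minus_sq m) - rank1 \<beta> m) (Q_hat \<beta> A m)
    (one_minus_sq w) (base_mat \<beta> A (one_minus_sq w) - rank1 \<beta> w) (Q_hat \<beta> A w) (2 * vnorm (m - w)) l"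
proof -
  note m' = S_domD(1)[OF m] S_domD(1)[OF w]
  note mc = open_cubeD(1)[OF m'(1)] open_cubeD(1)[OF m'(2)]
  note xc = mc[THEN one_minus_sq_carrier]
  let ?B = "base_mat \<beta> A (one_minus_sq m)" and ?B' = "base_mat \<beta> A (one_minus_sq w)"
  let ?d = "vnorm (m - w)"
  note carr = xc[THEN base_carrier] mc[THEN rank1_carrier]
  have "(?B - rank1 \<beta> m) - (?B' - rank1 \<beta> w) = (?B - ?B') - (rank1 \<beta> m - rank1 \<beta> w)"
    using carr by (intro eq_matI) auto
  then have "norm_F ((?B - rank1 \<beta> m) - (?B' - rank1 \<beta> w))
      \<le> norm_F (?B - ?B') + norm_F (rank1 \<beta> m - rank1 \<beta> w)"
    using carr by (auto intro!: norm_F_diff_le[of _ n n] minus_carrier_mat)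
  also have "\<dots> \<le> \<beta>\<^sup>2 * (2 * ?d) + 4 * \<beta>\<^sup>2 * ?d"
  proof (intro add_mono)
    show "norm_F (?B - ?B') \<le> \<beta>\<^sup>2 * (2 * ?d)"
      using norm_F_base_diff[OF xc] one_minus_sq_diff[OF m']
      by (meson mult_left_mono order_trans zero_le_power2)
    have "4 * \<beta>\<^sup>2 * ?d / sqrt (real n) \<le> 4 * \<beta>\<^sup>2 * ?d / 1"
      using n_pos by (intro divide_left_mono) auto
    then show "norm_F (rank1 \<beta> m - rank1 \<beta> w) \<le> 4 * \<beta>\<^sup>2 * ?d"
      using rank1_diff[OF m'] by simp
  qed
  finally have "norm_F ((?B - rank1 \<beta> m) - (?B' - rank1 \<beta> w)) \<le> l * (2 * ?d)"
    by (simp add: mult_ac)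
  then show ?thesis
    using resolvent_Q[OF m] resolvent_Q[OF w] one_minus_sq_diff[OF m']
    by (simp add: resolvent_pair_def resolvent_pair_axioms_def)
qed

end

section \<open>The drift\<close>

lemma diff_mat_vec_le:
  fixes X X' :: "real mat"
  assumes X: "X \<in> carrier_mat n n" and X': "X' \<in> carrier_mat n n"
    and m: "m \<in> carrier_vec n" and w: "w \<in> carrier_vec n"
  shows "vnorm (X *\<^sub>v m - X' *\<^sub>v w) \<le> vnorm (X *\<^sub>v (m - w)) + vnorm ((X - X') *\<^sub>v w)"
proof -
  have "X *\<^sub>v m - X' *\<^sub>v w = X *\<^sub>v (m - w) + (X - X') *\<^sub>v w"
    using assms by (intro eq_vecI) 
      (auto simp: mult_minus_distrib_mat_vec[of _ n n] minus_mult_distrib_mat_vec[of _ n n])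
  moreover have "X *\<^sub>v (m - w) \<in> carrier_vec n" "(X - X') *\<^sub>v w \<in> carrier_vec n"
    using assms by (auto intro!: mult_mat_vec_carrier[of _ n n] minus_carrier_mat)
  ultimately show ?thesis
    by (simp add: vnorm_add_le[of _ n])
qed

lemma vec_diff_rearrange:
  fixes p q r t :: "real vec"
  assumes "p \<in> carrier_vec n" "q \<in> carrier_vec n" "r \<in> carrier_vec n" "t \<in> carrier_vec n"
  shows "(p - s \<cdot>\<^sub>v q) - (r - s \<cdot>\<^sub>v t) = (p - r) - s \<cdot>\<^sub>v (q - t)"
  using assms by (intro eq_vecI) (auto simp: algebra_simps)

lemma norm_F_le_diff:
  assumes "X \<in> carrier_mat n m" "Y \<in> carrier_mat n m"
  shows "norm_F X \<le> norm_F (X - Y) + norm_F Y"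
proof -
  have "X = (X - Y) + Y" using assms by (intro eq_matI) auto
  then show ?thesis using norm_F_add_le[of "X - Y" n m Y] assms by (metis minus_carrier_mat)
qed

lemma (in resolvent) defect_diagonal: "defect \<beta> D R = mat_diag n (\<lambda>i. defect \<beta> D R $$ (i, i))"
  by (intro eq_matI) (auto simp: defect_def diag_proj_def mat_diag_def)

lemma mtrace_mat_diag: "mtrace (mat_diag n f) = (\<Sum>i<n. f i)"
  by (simp add: mtrace_def mat_diag_def)

locale tap_Omega = tap +
  fixes C :: real
  assumes C_pos: "0 < C" and A_Omega: "A \<in> Omega C \<beta> c n"
begin

text \<open>
  The bound in \<open>\<Omega>\<close>, times \<open>\<surd>n\<close> to pass from the normalized norm to the Frobenius norm.
\<close>

definition Omega_bound where "Omega_bound = C * \<beta> / (gamma_Y \<beta> c)\<^sup>2"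

lemma Omega_bound_nonneg: "0 \<le> Omega_bound"
  using C_pos \<beta>_pos by (simp add: Omega_bound_def)

abbreviation "diag_inv x \<equiv> mat_diag n (\<lambda>i. 1 / x $ i)"

lemma Y_mat_inv_diag:
  assumes "x \<in> carrier_vec n" "\<And>i. i < n \<Longrightarrow> 0 < x $ i"
  shows "Y_mat \<beta> A (diag_inv x) = Y_of \<beta> A x"
proof -
  have "minv (diag_inv x) = mat_diag n (\<lambda>i. x $ i)"
    using assms(2) by (intro minv_mat_diag) force
  then show ?thesis
    using assms(1)
    by (simp add: Y_mat_def Y_of_def base_mat_def inv_diag_def ntrace_def mtrace_mat_diag)
      (simp add: mat_diag_def)
qed

lemma diag_inv_in_S_D:
  assumes x: "x \<in> admissible \<beta> A c n"
  shows "diag_inv x \<in> S_D \<beta> c n A"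
proof -
  note a = admissibleD[OF x]
  have "diag_inv x \<in> diag_mats n {1..}"
    using a by (auto simp: diag_mats_def diagonal_mat_def mat_diag_def)
  moreover have "loewner_le n (c \<cdot>\<^sub>m 1\<^sub>m n) (Y_mat \<beta> A (diag_inv x))"
  proof -
    let ?Z = "Y_of \<beta> A x - c \<cdot>\<^sub>m 1\<^sub>m n"
    have "transpose_mat (c \<cdot>\<^sub>m 1\<^sub>m n) = (c \<cdot>\<^sub>m 1\<^sub>m n :: real mat)"
      by (intro eq_matI) auto
    then have "transpose_mat ?Z = ?Z"
      using Y_carrier[OF a(1)] by (simp add: transpose_minus[of _ n n] Y_sym[OF a(1)])
    moreover have "0 \<le> v \<bullet> (?Z *\<^sub>v v)" if v: "v \<in> carrier_vec n" for v
      using a(4)[OF v] v Y_carrier[OF a(1)]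
      by (simp add: diff_mult_vec[of _ n] smult_mult_vec[of _ n] vnorm_square)
    moreover have "?Z \<in> carrier_mat n n"
      by (simp add: minus_carrier_mat)
    ultimately show ?thesis
      by (simp add: loewner_le_def pos_semidef_def Y_mat_inv_diag[OF a(1,2)])
  qed
  ultimately show ?thesis by (simp add: S_D_def)
qed

text \<open>
  \<open>\<Omega>\<close> bounds \<open>E = E[D R\<^sup>2 D] - s I\<close>. Pairing \<open>E\<close> with \<open>diag(x\<^sub>i\<^sup>2) = D\<^sup>-\<^sup>2\<close> gives \<open>n (tr\<^sub>n(R\<^sup>2) - t s)\<close>, where
  \<open>t = tr\<^sub>n(D\<^sup>-\<^sup>2)\<close>, so the scalar in the defect, \<open>1 + \<beta>\<^sup>2 tr\<^sub>n(R\<^sup>2)\<close>, is within \<open>O(1/\<surd>n)\<close> of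
  \<open>1 + \<beta>\<^sup>2 t s = s\<close>. Each of the two errors contributes at most \<open>Omega_bound\<close>.
\<close>

lemma norm_F_defect_R:
  assumes x: "x \<in> admissible \<beta> A c n"
  shows "norm_F (defect \<beta> (diag_inv x) (R_of \<beta> A x)) \<le> 2 * Omega_bound"
proof -
  note a = admissibleD[OF x]
  interpret resolvent n c g x "base_mat \<beta> A x" "R_of \<beta> A x"
    by (rule resolvent_R[OF x])
  let ?R = "R_of \<beta> A x"
  let ?X = "diag_inv x * (?R * ?R) * diag_inv x"
  define t where "t = (\<Sum>i<n. (x $ i)\<^sup>2) / real n"
  define s where "s = 1 / (1 - \<beta>\<^sup>2 * t)"
  define \<tau> where "\<tau> = ntrace (?R * ?R)"
  define E where "E = diag_proj ?X - s \<cdot>\<^sub>m 1\<^sub>m n"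
  have Xc [simp]: "?X \<in> carrier_mat n n"
    by (simp add: square_carrier)
  have Ec [simp]: "E \<in> carrier_mat n n"
    by (simp add: E_def minus_carrier_mat)
  have "minv (diag_inv x) ^\<^sub>m 2 = mat_diag n (\<lambda>i. (x $ i)\<^sup>2)"
  proof -
    have "minv (diag_inv x) = mat_diag n (\<lambda>i. x $ i)"
      using a(2) by (intro minv_mat_diag) force
    then show ?thesis
      by (simp add: pow_mat_2[of _ n] power2_eq_square)
  qed
  then have "ntrace (minv (diag_inv x) ^\<^sub>m 2) = t"
    by (simp add: ntrace_def mtrace_mat_diag t_def) (simp add: mat_diag_def)
  moreover have "minv (Y_mat \<beta> A (diag_inv x)) ^\<^sub>m 2 = ?R * ?R"
    using R_carrier[OF x] by (simp add: Y_mat_inv_diag[OF a(1,2)] pow_mat_2[of _ n] flip: R_of_def)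
  ultimately have "norm_L2 E \<le> C * \<beta> / ((gamma_Y \<beta> c)\<^sup>2 * sqrt (real n))"
    using A_Omega diag_inv_in_S_D[OF x] by (auto simp: Omega_def E_def s_def)
  moreover have "norm_L2 E = norm_F E / sqrt (real n)"
    using carrier_matD(2)[OF Ec] by (simp add: norm_L2_def norm_F_def ntrace_def real_sqrt_divide)
  ultimately have E_le: "norm_F E \<le> Omega_bound"
    using n_pos by (simp add: Omega_bound_def field_simps)
  have x2: "(x $ i)\<^sup>2 \<le> 1" if "i < n" for i
    using a(2,3)[OF that] by (simp add: abs_square_le_1)
  have t1: "0 \<le> t" "t \<le> 1"
    using sum_mono[of "{..<n}" "\<lambda>i. (x $ i)\<^sup>2" "\<lambda>_. 1"] x2 n_pos
    by (auto simp: t_def sum_nonneg)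
  have b2: "\<beta>\<^sup>2 < 1"
    using \<beta>_pos \<beta>_less_1 by (simp add: abs_square_less_1)
  then have "\<beta>\<^sup>2 * t < 1"
    using t1 mult_left_le[of t "\<beta>\<^sup>2"] by simp
  then have s1: "s - 1 = \<beta>\<^sup>2 * (t * s)"
    by (simp add: s_def field_simps)
  have diag: "(?R * ?R) $$ (i, i) = (x $ i)\<^sup>2 * ?X $$ (i, i)" if i: "i < n" for i
  proof -
    have "diag_inv x * (?R * ?R) = Matrix.mat n n (\<lambda>(i,j). 1 / x $ i * (?R * ?R) $$ (i,j))"
      by (intro mat_diag_mult_left) (simp add: square_carrier)
    then have "?X $$ (i, i) = 1 / x $ i * (?R * ?R) $$ (i, i) * (1 / x $ i)"
      using i mat_diag_mult_right[of "diag_inv x * (?R * ?R)" n n "\<lambda>i. 1 / x $ i"]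
      by (simp add: square_carrier del: index_mult_mat(1))
    then show ?thesis
      using a(2)[OF i] by (simp add: power2_eq_square del: index_mult_mat(1))
  qed
  have "mtrace (mat_diag n (\<lambda>i. (x $ i)\<^sup>2) * E) = real n * (\<tau> - t * s)"
  proof -
    have "mtrace (mat_diag n (\<lambda>i. (x $ i)\<^sup>2) * E) = (\<Sum>i<n. (?R * ?R) $$ (i, i) - (x $ i)\<^sup>2 * s)"
      unfolding mtrace_mat_diag_mult[OF Ec]
      by (intro sum.cong) (auto simp: diag E_def diag_proj_def right_diff_distrib simp del: index_mult_mat(1))
    also have "\<dots> = mtrace (?R * ?R) - (\<Sum>i<n. (x $ i)\<^sup>2) * s"
      by (simp add: sum_subtractf sum_distrib_right mtrace_def del: index_mult_mat(1))
    moreover have "real n * \<tau> = mtrace (?R * ?R)" "real n * t = (\<Sum>i<n. (x $ i)\<^sup>2)"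
      using n_pos by (simp_all add: \<tau>_def t_def ntrace_def)
    ultimately show ?thesis
      by (simp add: right_diff_distrib flip: mult.assoc)
  qed
  moreover have "norm_F (mat_diag n (\<lambda>i. (x $ i)\<^sup>2)) \<le> sqrt (real n)"
  proof -
    have "(\<Sum>i<n. ((x $ i)\<^sup>2)\<^sup>2) \<le> (\<Sum>i<n. 1)"
      using power_mono[OF x2 zero_le_power2, of _ 2] by (intro sum_mono) simp
    then show ?thesis by (simp add: norm_F_mat_diag L2_set_def)
  qed
  then have "norm_F (mat_diag n (\<lambda>i. (x $ i)\<^sup>2)) * norm_F E \<le> sqrt (real n) * Omega_bound"
    using E_le by (intro mult_mono) auto
  ultimately have "real n * \<bar>\<tau> - t * s\<bar> \<le> sqrt (real n) * Omega_bound"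
    using abs_mtrace_mult_le[of "mat_diag n (\<lambda>i. (x $ i)\<^sup>2)" n E] by (simp add: abs_mult)
  then have "sqrt (real n) * (\<bar>\<tau> - t * s\<bar> * sqrt (real n)) \<le> sqrt (real n) * Omega_bound"
    using real_sqrt_mult_self[of "real n"] by (metis abs_of_nat mult.assoc mult.commute)
  then have \<tau>: "\<bar>\<tau> - t * s\<bar> * sqrt (real n) \<le> Omega_bound"
    using n_pos by simp
  have "defect \<beta> D ?R = E - (1 + \<beta>\<^sup>2 * \<tau> - s) \<cdot>\<^sub>m 1\<^sub>m n"
    by (intro eq_matI) (auto simp: defect_def E_def \<tau>_def diag_proj_def)
  then have "norm_F (defect \<beta> D ?R) \<le> norm_F E + norm_F ((1 + \<beta>\<^sup>2 * \<tau> - s) \<cdot>\<^sub>m 1\<^sub>m n)"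
    by (auto intro!: norm_F_diff_le[of _ n n])
  also have "norm_F ((1 + \<beta>\<^sup>2 * \<tau> - s) \<cdot>\<^sub>m 1\<^sub>m n) = \<beta>\<^sup>2 * (\<bar>\<tau> - t * s\<bar> * sqrt (real n))"
  proof -
    have "1 + \<beta>\<^sup>2 * \<tau> - s = \<beta>\<^sup>2 * (\<tau> - t * s)"
      using s1 by (simp add: algebra_simps)
    then show ?thesis by (simp add: norm_F_smult norm_F_one abs_mult)
  qed
  also have "norm_F E + \<beta>\<^sup>2 * (\<bar>\<tau> - t * s\<bar> * sqrt (real n)) \<le> Omega_bound + 1 * Omega_bound"
    using E_le \<tau> b2 by (intro add_mono mult_mono) auto
  finally show ?thesis by simp
qed

definition defect_bound_Q where "defect_bound_Q = 2 * Omega_bound + lip_defect \<beta> c g l"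

definition drift_size where "drift_size = defect_bound_Q + 2 * \<beta>\<^sup>2 / c\<^sup>2"

abbreviation "Q_defect m \<equiv> defect \<beta> (diag_inv (one_minus_sq m)) (Q_hat \<beta> A m)"

abbreviation "Q_sq m \<equiv> Q_hat \<beta> A m * Q_hat \<beta> A m"

lemma norm_F_defect_Q:
  assumes m: "m \<in> S_dom \<beta> n A c"
  shows "norm_F (Q_defect m) \<le> defect_bound_Q"
proof -
  interpret resolvent_pair n c g "one_minus_sq m" "base_mat \<beta> A (one_minus_sq m) - rank1 \<beta> m" "Q_hat \<beta> A m"
    "one_minus_sq m" "base_mat \<beta> A (one_minus_sq m)" "R_of \<beta> A (one_minus_sq m)" 1 l
    by (rule pair_QR[OF m])
  show ?thesis
    using norm_F_le_diff[OF p.defect_carrier[of \<beta>] q.defect_carrier[of \<beta>]] norm_F_defect_diff[of \<beta>]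
      norm_F_defect_R[OF one_minus_sq_admissible[OF m]] unfolding defect_bound_Q_def by linarith
qed

text \<open>
  The scalar \<open>1\<close> in the defect is the subtracted \<open>m\<close>.
\<close>

lemma drift_eq:
  assumes m: "m \<in> S_dom \<beta> n A c"
  shows "f_drift \<beta> A m - m = Q_defect m *\<^sub>v m - (2 * \<beta>\<^sup>2 / real n) \<cdot>\<^sub>v (Q_sq m *\<^sub>v m)"
proof -
  interpret resolvent n c g "one_minus_sq m" "base_mat \<beta> A (one_minus_sq m) - rank1 \<beta> m" "Q_hat \<beta> A m"
    by (rule resolvent_Q[OF m])
  note mc = open_cubeD(1)[OF S_domD(1)[OF m]]
  let ?Q = "Q_hat \<beta> A m"
  let ?s = "2 * \<beta>\<^sup>2 / real n"
  have D: "D_mat m = D"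
    using mc by (intro eq_matI) (auto simp: D_mat_def one_minus_sq_def mat_diag_def)
  have Q_sq: "?Q ^\<^sub>m 2 = Q_sq m"
    by (rule pow_mat_2[OF carriers(2)])
  have [simp]: "Q_sq m \<in> carrier_mat n n"
    by (simp add: square_carrier)
  have "diag_proj (D * Q_sq m * D) - (\<beta>\<^sup>2 * ntrace (Q_sq m)) \<cdot>\<^sub>m 1\<^sub>m n - ?s \<cdot>\<^sub>m Q_sq m
      = (Q_defect m - ?s \<cdot>\<^sub>m Q_sq m) + 1\<^sub>m n"
    by (intro eq_matI) (auto simp: defect_def diag_proj_def simp del: index_mult_mat(1))
  then have "f_drift \<beta> A m = ((Q_defect m - ?s \<cdot>\<^sub>m Q_sq m) + 1\<^sub>m n) *\<^sub>v m"
    using mc by (simp add: f_drift_def Let_def D Q_sq)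
  also have "\<dots> = (Q_defect m *\<^sub>v m - (?s \<cdot>\<^sub>m Q_sq m) *\<^sub>v m) + m"
    using mc by (simp add: add_mult_distrib_mat_vec[of _ n n] minus_mult_distrib_mat_vec[of _ n n] minus_carrier_mat)
  also have "(?s \<cdot>\<^sub>m Q_sq m) *\<^sub>v m = ?s \<cdot>\<^sub>v (Q_sq m *\<^sub>v m)"
    using mc by (intro eq_vecI) auto
  finally show ?thesis
    using mc by (intro eq_vecI) auto
qed

lemma Q_carrier: "m \<in> S_dom \<beta> n A c \<Longrightarrow> Q_hat \<beta> A m \<in> carrier_mat n n"
  by (rule resolvent.carriers(2)[OF resolvent_Q])

lemma Q_bound: "m \<in> S_dom \<beta> n A c \<Longrightarrow> op_bound n (1 / c) (Q_hat \<beta> A m)"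
  by (rule resolvent.R_bound[OF resolvent_Q])

lemma Q_defect_carrier: "m \<in> S_dom \<beta> n A c \<Longrightarrow> Q_defect m \<in> carrier_mat n n"
  by (rule resolvent.defect_carrier[OF resolvent_Q])

lemma vnorm_Q_defect_mult_le:
  assumes m: "m \<in> S_dom \<beta> n A c" and v: "v \<in> carrier_vec n"
  shows "vnorm (Q_defect m *\<^sub>v v) \<le> defect_bound_Q * vnorm v"
  using vnorm_mult_mat_vec_le[OF Q_defect_carrier[OF m] v] norm_F_defect_Q[OF m]
  by (meson mult_right_mono order_trans vnorm_nonneg)

lemma Q_sq_bound: "m \<in> S_dom \<beta> n A c \<Longrightarrow> op_bound n (1 / c\<^sup>2) (Q_sq m)"
  using op_bound_mult[OF Q_bound Q_bound] by (simp add: power2_eq_square)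

text \<open>
  The defect is diagonal and \<open>m\<close> lies in the cube, so its contribution is at most its Frobenius
  norm. The remaining term carries an explicit \<open>1/n\<close>.
\<close>

lemma drift_bound:
  assumes m: "m \<in> S_dom \<beta> n A c"
  shows "vnorm (f_drift \<beta> A m - m) \<le> drift_size"
proof -
  note m' = S_domD(1)[OF m]
  note mc = open_cubeD(1)[OF m']
  let ?s = "2 * \<beta>\<^sup>2 / real n"
  have "vnorm (f_drift \<beta> A m - m) \<le> vnorm (Q_defect m *\<^sub>v m) + vnorm (?s \<cdot>\<^sub>v (Q_sq m *\<^sub>v m))"
    unfolding drift_eq[OF m] using Q_defect_carrier[OF m] op_boundD(2)[OF Q_sq_bound[OF m]] mc
    by (intro vnorm_diff_le[of _ n]) auto
  also have "vnorm (Q_defect m *\<^sub>v m) \<le> defect_bound_Q"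
  proof -
    have "Q_defect m = mat_diag n (\<lambda>i. Q_defect m $$ (i, i))"
      by (rule resolvent.defect_diagonal[OF resolvent_Q[OF m]])
    then have "vnorm (Q_defect m *\<^sub>v m) \<le> norm_F (Q_defect m)"
      using vnorm_mat_diag_mult_le[OF mc, of "\<lambda>i. Q_defect m $$ (i, i)"] open_cubeD(2)[OF m']
      by (metis less_imp_le)
    with norm_F_defect_Q[OF m] show ?thesis by simp
  qed
  also have "vnorm (?s \<cdot>\<^sub>v (Q_sq m *\<^sub>v m)) \<le> 2 * \<beta>\<^sup>2 / c\<^sup>2"
  proof -
    have "?s * vnorm (Q_sq m *\<^sub>v m) \<le> ?s * (1 / c\<^sup>2 * vnorm m)"
      by (intro mult_left_mono op_boundD(3)[OF Q_sq_bound[OF m] mc]) simp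
    also have "\<dots> \<le> ?s * (1 / c\<^sup>2 * real n)"
    proof -
      have "sqrt (real n) \<le> real n"
        using n_pos by (intro real_le_lsqrt) (auto simp: power2_eq_square)
      then show ?thesis
        using vnorm_cube[OF m'] by (intro mult_left_mono) auto
    qed
    also have "\<dots> = 2 * \<beta>\<^sup>2 / c\<^sup>2"
      using n_pos by simp
    finally show ?thesis by (simp add: vnorm_smult)
  qed
  finally show ?thesis by (simp add: drift_size_def)
qed

lemma Q_lipschitz:
  assumes m: "m \<in> S_dom \<beta> n A c" and w: "w \<in> S_dom \<beta> n A c"
  shows "norm_F (Q_hat \<beta> A m - Q_hat \<beta> A w) \<le> 2 * lip_R c g l * vnorm (m - w)"
  using resolvent_pair.norm_F_R_diff[OF pair_QQ[OF m w]] by (simp add: mult_ac)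

definition lip_drift where "lip_drift = defect_bound_Q + 2 * lip_defect \<beta> c g l + 2 * \<beta>\<^sup>2 * (1 / c\<^sup>2 + 4 * lip_R c g l / c)"

text \<open>
  In the difference of \<open>Z(m) m\<close> and \<open>Z(w) w\<close>, where \<open>Z\<close> is the defect, \<open>Z(m)\<close> acts on \<open>m - w\<close> and is
  bounded, while \<open>Z(m) - Z(w)\<close> is diagonal and acts on a vector of the cube.
\<close>

lemma drift_lipschitz:
  assumes m: "m \<in> S_dom \<beta> n A c" and w: "w \<in> S_dom \<beta> n A c"
  shows "vnorm ((f_drift \<beta> A m - m) - (f_drift \<beta> A w - w)) \<le> lip_drift * vnorm (m - w)"
proof -
  interpret resolvent_pair n c g "one_minus_sq m" "base_mat \<beta> A (one_minus_sq m) - rank1 \<beta> m" "Q_hat \<beta> A m"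
    "one_minus_sq w" "base_mat \<beta> A (one_minus_sq w) - rank1 \<beta> w" "Q_hat \<beta> A w" "2 * vnorm (m - w)" l
    by (rule pair_QQ[OF m w])
  note m' = S_domD(1)[OF m] and w' = S_domD(1)[OF w]
  note mc = open_cubeD(1)[OF m'] and wc = open_cubeD(1)[OF w']
  let ?s = "2 * \<beta>\<^sup>2 / real n" and ?d = "vnorm (m - w)"
  note Q_sq_carr = op_boundD(2)[OF Q_sq_bound[OF m]] op_boundD(2)[OF Q_sq_bound[OF w]]
  have d: "m - w \<in> carrier_vec n" using mc wc by simp
  have 1: "vnorm (Q_defect m *\<^sub>v m - Q_defect w *\<^sub>v w) \<le> defect_bound_Q * ?d + lip_defect \<beta> c g l * (2 * ?d)"
  proof -
    have "Q_defect m - Q_defect w = mat_diag n (\<lambda>i. Q_defect m $$ (i, i) - Q_defect w $$ (i, i))"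
      by (subst p.defect_diagonal, subst q.defect_diagonal) (intro eq_matI, auto simp: mat_diag_def)
    then have "vnorm ((Q_defect m - Q_defect w) *\<^sub>v w) \<le> norm_F (Q_defect m - Q_defect w)"
      by (simp only:) (intro vnorm_mat_diag_mult_le wc less_imp_le open_cubeD(2)[OF w'])
    then show ?thesis
      using diff_mat_vec_le[OF Q_defect_carrier[OF m] Q_defect_carrier[OF w] mc wc] vnorm_Q_defect_mult_le[OF m d]
        norm_F_defect_diff[of \<beta>] by linarith
  qed
  have 2: "vnorm (Q_sq m *\<^sub>v m - Q_sq w *\<^sub>v w) \<le> real n * ((1 / c\<^sup>2 + 4 * lip_R c g l / c) * ?d)"
  proof -
    have n1: "1 \<le> real n" "sqrt (real n) \<le> real n"
      using n_pos by (auto intro!: real_le_lsqrt simp: power2_eq_square)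
    have "vnorm (Q_sq m *\<^sub>v (m - w)) \<le> 1 / c\<^sup>2 * ?d"
      by (rule op_boundD(3)[OF Q_sq_bound[OF m] d])
    also have "\<dots> \<le> real n * (1 / c\<^sup>2 * ?d)"
      using mult_right_mono[OF n1(1), of "1 / c\<^sup>2 * ?d"] by simp
    finally have a: "vnorm (Q_sq m *\<^sub>v (m - w)) \<le> real n * (1 / c\<^sup>2 * ?d)" .
    have "vnorm ((Q_sq m - Q_sq w) *\<^sub>v w) \<le> norm_F (Q_sq m - Q_sq w) * vnorm w"
      using Q_sq_carr wc by (intro vnorm_mult_mat_vec_le[of _ n]) (auto simp: minus_carrier_mat)
    also have "\<dots> \<le> norm_F (Q_sq m - Q_sq w) * real n"
      using vnorm_cube[OF w'] n1 by (intro mult_left_mono) auto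
    also have "\<dots> \<le> (2 * lip_R c g l / c * (2 * ?d)) * real n"
      by (intro mult_right_mono norm_F_square_diff) simp
    finally have b: "vnorm ((Q_sq m - Q_sq w) *\<^sub>v w) \<le> real n * (4 * lip_R c g l / c * ?d)"
      by (simp add: mult_ac)
    show ?thesis
      using diff_mat_vec_le[OF Q_sq_carr mc wc] a b by (simp add: distrib_right distrib_left)
  qed
  note carr = mult_mat_vec_carrier[OF Q_defect_carrier[OF m] mc] mult_mat_vec_carrier[OF Q_sq_carr(1) mc]
    mult_mat_vec_carrier[OF Q_defect_carrier[OF w] wc] mult_mat_vec_carrier[OF Q_sq_carr(2) wc]
  have "(f_drift \<beta> A m - m) - (f_drift \<beta> A w - w)
      = (Q_defect m *\<^sub>v m - Q_defect w *\<^sub>v w) - ?s \<cdot>\<^sub>v (Q_sq m *\<^sub>v m - Q_sq w *\<^sub>v w)"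
    unfolding drift_eq[OF m] drift_eq[OF w] by (rule vec_diff_rearrange[OF carr])
  moreover have "vnorm ((Q_defect m *\<^sub>v m - Q_defect w *\<^sub>v w) - ?s \<cdot>\<^sub>v (Q_sq m *\<^sub>v m - Q_sq w *\<^sub>v w))
      \<le> vnorm (Q_defect m *\<^sub>v m - Q_defect w *\<^sub>v w) + vnorm (?s \<cdot>\<^sub>v (Q_sq m *\<^sub>v m - Q_sq w *\<^sub>v w))"
    by (intro vnorm_diff_le[of _ n] minus_carrier_vec smult_carrier_vec[THEN iffD2] carr)
  ultimately have "vnorm ((f_drift \<beta> A m - m) - (f_drift \<beta> A w - w))
      \<le> vnorm (Q_defect m *\<^sub>v m - Q_defect w *\<^sub>v w) + ?s * vnorm (Q_sq m *\<^sub>v m - Q_sq w *\<^sub>v w)"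
    by (simp only: vnorm_smult) simp
  also have "\<dots> \<le> (defect_bound_Q * ?d + lip_defect \<beta> c g l * (2 * ?d))
      + ?s * (real n * ((1 / c\<^sup>2 + 4 * lip_R c g l / c) * ?d))"
    by (intro add_mono 1 mult_left_mono 2) simp
  also have "\<dots> = lip_drift * ?d"
    using n_pos by (simp add: lip_drift_def algebra_simps)
  finally show ?thesis .
qed

text \<open>
  The variation of \<open>Q\<close> is multiplied by \<open>w - f(w)\<close>. Since this vector is \<open>O(1)\<close>, and not of size
  \<open>\<surd>n\<close> like \<open>w\<close>, the constant is independent of the dimension.
\<close>

lemma preconditioned_drift_lipschitz:
  assumes m: "m \<in> S_dom \<beta> n A c" and w: "w \<in> S_dom \<beta> n A c"
  shows "vnorm (Q_hat \<beta> A m *\<^sub>v (m - f_drift \<beta> A m) - Q_hat \<beta> A w *\<^sub>v (w - f_drift \<beta> A w))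
    \<le> (2 * lip_R c g l * drift_size + lip_drift / c) * vnorm (m - w)"
proof -
  let ?u = "m - f_drift \<beta> A m" and ?v = "w - f_drift \<beta> A w" and ?d = "vnorm (m - w)"
  note mc = open_cubeD(1)[OF S_domD(1)[OF m]] and wc = open_cubeD(1)[OF S_domD(1)[OF w]]
  have fc: "f_drift \<beta> A m \<in> carrier_vec n" "f_drift \<beta> A w \<in> carrier_vec n"
    using mc wc Q_carrier[OF m] Q_carrier[OF w]
    by (auto simp: f_drift_def Let_def intro!: mult_mat_vec_carrier[of _ n n])
  have "vnorm (Q_hat \<beta> A m *\<^sub>v ?u - Q_hat \<beta> A w *\<^sub>v ?v)
      \<le> vnorm (Q_hat \<beta> A m *\<^sub>v (?u - ?v)) + vnorm ((Q_hat \<beta> A m - Q_hat \<beta> A w) *\<^sub>v ?v)"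
    using mc wc fc by (intro diff_mat_vec_le[OF Q_carrier[OF m] Q_carrier[OF w]]) auto
  also have "vnorm (Q_hat \<beta> A m *\<^sub>v (?u - ?v)) \<le> 1 / c * (lip_drift * ?d)"
  proof -
    have "?u - ?v = (-1) \<cdot>\<^sub>v ((f_drift \<beta> A m - m) - (f_drift \<beta> A w - w))"
      using mc wc fc by (intro eq_vecI) auto
    then have "vnorm (?u - ?v) \<le> lip_drift * ?d"
      using drift_lipschitz[OF m w] by (simp add: vnorm_smult)
    then have "1 / c * vnorm (?u - ?v) \<le> 1 / c * (lip_drift * ?d)"
      using c_pos by (intro mult_left_mono) auto
    moreover have "vnorm (Q_hat \<beta> A m *\<^sub>v (?u - ?v)) \<le> 1 / c * vnorm (?u - ?v)"
      using mc wc fc by (intro op_boundD(3)[OF Q_bound[OF m]]) auto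
    ultimately show ?thesis by linarith
  qed
  also have "vnorm ((Q_hat \<beta> A m - Q_hat \<beta> A w) *\<^sub>v ?v) \<le> (2 * lip_R c g l * ?d) * drift_size"
  proof -
    have "vnorm ((Q_hat \<beta> A m - Q_hat \<beta> A w) *\<^sub>v ?v) \<le> norm_F (Q_hat \<beta> A m - Q_hat \<beta> A w) * vnorm ?v"
      using Q_carrier[OF m] Q_carrier[OF w] wc fc
      by (intro vnorm_mult_mat_vec_le[of _ n]) (auto simp: minus_carrier_mat)
    also have "\<dots> \<le> (2 * lip_R c g l * ?d) * drift_size"
    proof (rule mult_mono)
      show "norm_F (Q_hat \<beta> A m - Q_hat \<beta> A w) \<le> 2 * lip_R c g l * ?d"
        by (rule Q_lipschitz[OF m w])
      then show "0 \<le> 2 * lip_R c g l * ?d"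
        using norm_F_nonneg order_trans by blast
      show "vnorm ?v \<le> drift_size"
        using drift_bound[OF w] vnorm_minus_commute[OF wc fc(2)] by simp
    qed simp
    finally show ?thesis .
  qed
  finally show ?thesis
    by (simp add: algebra_simps)
qed

end

section \<open>Lipschitz continuity of the trace functional\<close>

text \<open>
  Cutting the unit interval into \<open>N\<close> pieces turns the quadratic error into \<open>M/N\<close>, which tends to \<open>0\<close>.
  This replaces differentiation along a path.
\<close>

lemma chain_bound:
  fixes F :: "real \<Rightarrow> real"
  assumes "\<And>s t. s \<in> {0..1} \<Longrightarrow> t \<in> {0..1} \<Longrightarrow> \<bar>F s - F t\<bar> \<le> k * \<bar>s - t\<bar> + M * \<bar>s - t\<bar>\<^sup>2"
  shows "\<bar>F 0 - F 1\<bar> \<le> k"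
proof -
  have step: "\<bar>F 0 - F 1\<bar> \<le> k + M / real (Suc N)" for N
  proof -
    let ?N = "real (Suc N)"
    have "F 0 - F 1 = (\<Sum>i<Suc N. F (real i / ?N) - F (real (Suc i) / ?N))"
      using sum_lessThan_telescope'[of "\<lambda>i. F (real i / ?N)" "Suc N"] by simp
    then have "\<bar>F 0 - F 1\<bar> \<le> (\<Sum>i<Suc N. \<bar>F (real i / ?N) - F (real (Suc i) / ?N)\<bar>)"
      by (simp only: sum_abs)
    also have "\<dots> \<le> (\<Sum>i<Suc N. k * (1 / ?N) + M * (1 / ?N)\<^sup>2)"
    proof (intro sum_mono)
      fix i assume "i \<in> {..<Suc N}"
      then have "real i / ?N \<in> {0..1}" "real (Suc i) / ?N \<in> {0..1}"
        by auto
      moreover have "\<bar>real i / ?N - real (Suc i) / ?N\<bar> = 1 / ?N"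
        by (simp flip: diff_divide_distrib)
      ultimately show "\<bar>F (real i / ?N) - F (real (Suc i) / ?N)\<bar> \<le> k * (1 / ?N) + M * (1 / ?N)\<^sup>2"
        using assms by metis
    qed
    also have "\<dots> = k + M / ?N"
    proof -
      have "x * (k * (1 / x) + M * (1 / x)\<^sup>2) = k + M / x" if "x \<noteq> 0" for x
        using that by (simp add: field_simps power2_eq_square)
      from this[of ?N] show ?thesis
        unfolding sum_constant card_lessThan by simp
    qed
    finally show ?thesis .
  qed
  have "(\<lambda>N. k + M / real (Suc N)) \<longlonglongrightarrow> k + 0"
    by (intro tendsto_add tendsto_const LIMSEQ_Suc lim_const_over_n)
  then show ?thesis
    using LIMSEQ_le_const[of "\<lambda>N. k + M / real (Suc N)" k "\<bar>F 0 - F 1\<bar>"] step by auto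
qed

definition seg :: "real vec \<Rightarrow> real vec \<Rightarrow> real \<Rightarrow> real vec" where
  "seg x y t = (1 - t) \<cdot>\<^sub>v x + t \<cdot>\<^sub>v y"

lemma seg_carrier: "x \<in> carrier_vec n \<Longrightarrow> y \<in> carrier_vec n \<Longrightarrow> seg x y t \<in> carrier_vec n"
  by (simp add: seg_def)

lemma seg_index: "x \<in> carrier_vec n \<Longrightarrow> y \<in> carrier_vec n \<Longrightarrow> i < n \<Longrightarrow>
    seg x y t $ i = (1 - t) * x $ i + t * y $ i"
  by (simp add: seg_def)

lemma vnorm_seg_diff:
  assumes "x \<in> carrier_vec n" "y \<in> carrier_vec n"
  shows "vnorm (seg x y s - seg x y t) = \<bar>s - t\<bar> * vnorm (x - y)"
proof -
  have "seg x y s - seg x y t = (t - s) \<cdot>\<^sub>v (x - y)"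
    using assms by (intro eq_vecI) (auto simp: seg_def algebra_simps)
  then show ?thesis by (simp add: vnorm_smult abs_minus_commute)
qed

lemma mult_outer:
  fixes X :: "real mat"
  assumes "X \<in> carrier_mat n n" "u \<in> carrier_vec n" "v \<in> carrier_vec n"
  shows "X * outer u v = outer (X *\<^sub>v u) v"
  using assms by (intro eq_matI) (auto simp: outer_def scalar_prod_def sum_distrib_left mult_ac)

lemma outer_mult:
  fixes X :: "real mat"
  assumes "X \<in> carrier_mat n n" "u \<in> carrier_vec n" "v \<in> carrier_vec n"
  shows "outer u v * X = outer u (transpose_mat X *\<^sub>v v)"
  using assms by (intro eq_matI) (auto simp: outer_def scalar_prod_def sum_distrib_left mult_ac)

lemma mtrace_outer:
  "u \<in> carrier_vec n \<Longrightarrow> v \<in> carrier_vec n \<Longrightarrow> mtrace (outer u v) = u \<bullet> v"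
  by (simp add: mtrace_def outer_def scalar_prod_def atLeast0LessThan)

context tap
begin

text \<open>
  Passing from \<open>x\<close> to \<open>y\<close> adds \<open>1/y\<^sub>i - 1/x\<^sub>i\<close> to the diagonal of \<open>Y\<close> and takes away \<open>\<beta>\<^sup>2\<close> times the decrease
  of the mean.
\<close>

lemma admissible_down:
  assumes x: "x \<in> admissible \<beta> A c n" and y: "y \<in> carrier_vec n"
    and pos: "\<And>i. i < n \<Longrightarrow> 0 < y $ i" and le: "\<And>i. i < n \<Longrightarrow> y $ i \<le> 1"
    and gain: "\<And>i. i < n \<Longrightarrow> \<beta>\<^sup>2 * ((\<Sum>j<n. x $ j - y $ j) / real n) \<le> 1 / y $ i - 1 / x $ i"
  shows "y \<in> admissible \<beta> A c n"
proof -
  note a = admissibleD[OF x]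
  define k where "k = \<beta>\<^sup>2 * ((\<Sum>j<n. x $ j - y $ j) / real n)"
  have "c * (vnorm v)\<^sup>2 \<le> v \<bullet> (Y_of \<beta> A y *\<^sub>v v)" if v: "v \<in> carrier_vec n" for v
  proof -
    have "base_mat \<beta> A x = base_mat \<beta> A y + k \<cdot>\<^sub>m 1\<^sub>m n"
      using a(1) y A_carrier by (intro eq_matI)
        (auto simp: base_mat_def k_def sum_subtractf diff_divide_distrib algebra_simps)
    then have "v \<bullet> (Y_of \<beta> A x *\<^sub>v v)
        = v \<bullet> (base_mat \<beta> A y *\<^sub>v v) + k * (v \<bullet> v) + (\<Sum>i<n. 1 / x $ i * (v $ i)\<^sup>2)"
      using v base_carrier[OF y] a(1)
      by (simp add: Y_of_def inv_diag_eq add_mult_vec[of _ n] smult_mult_vec[of _ n] scalar_prod_mat_diag)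
    moreover have "v \<bullet> (Y_of \<beta> A y *\<^sub>v v)
        = v \<bullet> (base_mat \<beta> A y *\<^sub>v v) + (\<Sum>i<n. 1 / y $ i * (v $ i)\<^sup>2)"
      using v base_carrier[OF y] y
      by (simp add: Y_of_def inv_diag_eq add_mult_vec[of _ n] scalar_prod_mat_diag)
    moreover have "k * (v \<bullet> v) + (\<Sum>i<n. 1 / x $ i * (v $ i)\<^sup>2) \<le> (\<Sum>i<n. 1 / y $ i * (v $ i)\<^sup>2)"
    proof -
      have "k * (v $ i)\<^sup>2 + 1 / x $ i * (v $ i)\<^sup>2 \<le> 1 / y $ i * (v $ i)\<^sup>2" if "i < n" for i
        using mult_right_mono[OF gain[OF that] zero_le_power2, of "v $ i"]
        unfolding k_def[symmetric] left_diff_distrib by linarith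
      then have "(\<Sum>i<n. k * (v $ i)\<^sup>2 + 1 / x $ i * (v $ i)\<^sup>2) \<le> (\<Sum>i<n. 1 / y $ i * (v $ i)\<^sup>2)"
        by (intro sum_mono) simp
      then show ?thesis
        using v by (simp add: sum.distrib sum_distrib_left flip: vnorm_square) (simp add: vnorm_square_sum sum_distrib_left)
    qed
    ultimately show ?thesis
      using a(4)[OF v] by linarith
  qed
  then show ?thesis
    using y pos le by (simp add: admissible_def)
qed

end

context tap_Omega
begin

text \<open>
  Twice \<open>\<omega>\<close> up to the constant \<open>n\<close> and the contribution of the rank-one term.
\<close>

definition potential where "potential x = mtrace (R_of \<beta> A x) - (\<Sum>i<n. x $ i)"

lemma potential_taylor:
  assumes x: "x \<in> admissible \<beta> A c n" and y: "y \<in> admissible \<beta> A c n"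
  shows "\<bar>potential x - potential y\<bar> \<le> 2 * Omega_bound * vnorm (x - y)
    + (\<beta>\<^sup>2 * lip_R c g l / c + (1 + g / c) * lip_RD c g l) * (vnorm (x - y))\<^sup>2"
proof -
  have "base_mat \<beta> A y - base_mat \<beta> A x = (\<beta>\<^sup>2 * ((\<Sum>i<n. y $ i - x $ i) / real n)) \<cdot>\<^sub>m 1\<^sub>m n"
    by (rule base_diff[OF admissibleD(1)[OF y] admissibleD(1)[OF x]])
  from resolvent_pair.trace_taylor[OF pair_RR[OF x y order_refl] this]
  have "\<bar>potential x - potential y\<bar> \<le> norm_F (defect \<beta> (diag_inv x) (R_of \<beta> A x)) * vnorm (x - y)
    + (\<beta>\<^sup>2 * lip_R c g l / c + (1 + g / c) * lip_RD c g l) * (vnorm (x - y))\<^sup>2"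
    by (simp only: potential_def)
  moreover have "norm_F (defect \<beta> (diag_inv x) (R_of \<beta> A x)) * vnorm (x - y) \<le> 2 * Omega_bound * vnorm (x - y)"
    by (intro mult_right_mono norm_F_defect_R[OF x]) simp
  ultimately show ?thesis by linarith
qed

lemma potential_segment:
  assumes x: "x \<in> carrier_vec n" and y: "y \<in> carrier_vec n"
    and seg: "\<And>t. t \<in> {0..1} \<Longrightarrow> seg x y t \<in> admissible \<beta> A c n"
  shows "\<bar>potential x - potential y\<bar> \<le> 2 * Omega_bound * vnorm (x - y)"
proof -
  let ?d = "vnorm (x - y)" and ?M = "\<beta>\<^sup>2 * lip_R c g l / c + (1 + g / c) * lip_RD c g l"
  have "\<bar>potential (seg x y 0) - potential (seg x y 1)\<bar> \<le> 2 * Omega_bound * ?d"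
  proof (rule chain_bound[where M = "?M * ?d\<^sup>2"])
    fix s t :: real assume "s \<in> {0..1}" "t \<in> {0..1}"
    then show "\<bar>potential (seg x y s) - potential (seg x y t)\<bar> \<le> 2 * Omega_bound * ?d * \<bar>s - t\<bar> + ?M * ?d\<^sup>2 * \<bar>s - t\<bar>\<^sup>2"
      using potential_taylor[OF seg seg, of s t] unfolding vnorm_seg_diff[OF x y]
      by (simp add: power_mult_distrib mult_ac)
  qed
  moreover have "seg x y 0 = x" "seg x y 1 = y"
    using x y by (auto simp: seg_def intro!: eq_vecI)
  ultimately show ?thesis by simp
qed

text \<open>
  The path is \<open>x \<rightarrow> r x \<rightarrow> r min(x, x')\<close>. On the first segment, at scale \<open>s\<close>, the entries \<open>1/x\<^sub>i\<close> have
  grown by at least \<open>1/s - 1\<close>, while the mean has dropped by at most \<open>1 - s\<close>, which is less. The second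
  segment stays below \<open>r x\<close> and keeps the gain \<open>\<tau> = 1/r - 1\<close>, while the mean has dropped by at most \<open>\<tau> + d\<close> in
  total, where \<open>d\<close> is the mean of \<open>\<bar>x\<^sub>i - x'\<^sub>i\<bar>\<close>. So it suffices that \<open>\<beta>\<^sup>2 (\<tau> + d) \<le> \<tau>\<close>, and the choice of \<open>r\<close>
  makes this an equality. The shrinking has length at most \<open>\<tau> \<surd>n\<close>, and \<open>d \<surd>n \<le> \<parallel>x - x'\<parallel>\<close>.
\<close>

lemma potential_descend:
  assumes x: "x \<in> admissible \<beta> A c n" and x': "x' \<in> admissible \<beta> A c n"
    and d: "d = (\<Sum>i<n. \<bar>x $ i - x' $ i\<bar>) / real n"
    and r: "r = 1 / (1 + \<beta>\<^sup>2 * d / (1 - \<beta>\<^sup>2))"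
    and z: "z = vec n (\<lambda>i. r * min (x $ i) (x' $ i))"
  shows "\<bar>potential x - potential z\<bar> \<le> 2 * Omega_bound / (1 - \<beta>\<^sup>2) * vnorm (x - x')"
proof -
  note a = admissibleD[OF x] and a' = admissibleD[OF x']
  have b2: "0 < \<beta>\<^sup>2" "\<beta>\<^sup>2 < 1"
    using \<beta>_pos \<beta>_less_1 by (simp_all add: abs_square_less_1)
  define \<tau> where "\<tau> = \<beta>\<^sup>2 * d / (1 - \<beta>\<^sup>2)"
  have d0: "0 \<le> d" unfolding d by (simp add: sum_nonneg)
  have \<tau>0: "0 \<le> \<tau>" using b2 d0 by (simp add: \<tau>_def)
  have r01: "0 < r" "r \<le> 1" and r\<tau>: "1 / r - 1 = \<tau>" "1 - r = r * \<tau>" "1 - r \<le> \<tau>"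
    using \<tau>0 mult_left_le_one_le[of \<tau> r] unfolding r \<tau>_def[symmetric] by (auto simp: field_simps)
  have \<tau>_eq: "\<beta>\<^sup>2 * (\<tau> + d) = \<tau>"
    using b2 by (simp add: \<tau>_def field_simps)
  have mean_le: "(\<Sum>i<n. x $ i) \<le> real n"
    using sum_mono[of "{..<n}" "\<lambda>i. x $ i" "\<lambda>_. 1"] a(3) by simp
  have sum_x0: "0 \<le> (\<Sum>i<n. x $ i)"
    using a(2) by (intro sum_nonneg) (auto simp: less_imp_le)
  have zc: "z \<in> carrier_vec n" and lx: "r \<cdot>\<^sub>v x \<in> carrier_vec n"
    using a(1) by (auto simp: z)
  have zi: "z $ i = r * min (x $ i) (x' $ i)" if "i < n" for i
    using that by (simp add: z)
  \<comment> \<open>On the first segment the condition \<open>\<beta> < 1\<close> alone makes the gain exceed the loss.\<close>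
  have down: "s \<cdot>\<^sub>v x \<in> admissible \<beta> A c n" if s: "0 < s" "s \<le> 1" for s
  proof (rule admissible_down[OF x])
    fix i assume i: "i < n"
    note xi = a(2)[OF i] a(3)[OF i]
    show "0 < (s \<cdot>\<^sub>v x) $ i" "(s \<cdot>\<^sub>v x) $ i \<le> 1"
      using i xi s a(1) mult_le_one[of s "x $ i"] by auto
    have "\<beta>\<^sup>2 * ((\<Sum>j<n. x $ j - (s \<cdot>\<^sub>v x) $ j) / real n) = \<beta>\<^sup>2 * ((1 - s) * ((\<Sum>i<n. x $ i) / real n))"
      using a(1) by (simp add: sum_subtractf sum_distrib_left left_diff_distrib diff_divide_distrib)
    also have "\<dots> \<le> 1 * ((1 - s) * 1)"
      using b2 s mean_le sum_x0 n_pos by (intro mult_mono) auto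
    also have "\<dots> \<le> 1 / s - 1"
      using s mult_right_le_one_le[of "1 - s" s] by (simp add: field_simps)
    also have "\<dots> \<le> (1 / s - 1) / x $ i"
      using xi s by (simp add: le_divide_eq mult_left_le)
    also have "\<dots> = 1 / (s \<cdot>\<^sub>v x) $ i - 1 / x $ i"
      using i xi s a(1) by (simp add: field_simps)
    finally show "\<beta>\<^sup>2 * ((\<Sum>j<n. x $ j - (s \<cdot>\<^sub>v x) $ j) / real n) \<le> 1 / (s \<cdot>\<^sub>v x) $ i - 1 / x $ i" .
  qed (use a(1) in simp)
  \<comment> \<open>On the second segment the gain is at least \<open>\<tau>\<close> and the loss at most \<open>\<beta>\<^sup>2 (\<tau> + d) = \<tau>\<close>.\<close>
  have across: "y \<in> admissible \<beta> A c n"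
    if y: "y \<in> carrier_vec n" and u: "\<And>i. i < n \<Longrightarrow> y $ i = r * u i"
      "\<And>i. i < n \<Longrightarrow> min (x $ i) (x' $ i) \<le> u i" "\<And>i. i < n \<Longrightarrow> u i \<le> x $ i" for y u
  proof (rule admissible_down[OF x y])
    fix i assume i: "i < n"
    note xi = a(2)[OF i] a(3)[OF i]
    have u0: "0 < u i" and u1: "u i \<le> 1"
      using u(2,3)[OF i] xi a'(2)[OF i] by auto
    show "0 < y $ i" "y $ i \<le> 1"
      using u(1)[OF i] u0 u1 r01 mult_le_one[of r "u i"] by auto
    have "(\<Sum>j<n. x $ j - y $ j) \<le> (\<Sum>j<n. (1 - r) + r * \<bar>x $ j - x' $ j\<bar>)"
    proof (intro sum_mono)
      fix j assume "j \<in> {..<n}"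
      then have j: "j < n" by simp
      have "x $ j - y $ j = (1 - r) * x $ j + r * (x $ j - u j)"
        using u(1)[OF j] by (simp add: algebra_simps)
      also have "\<dots> \<le> (1 - r) * 1 + r * \<bar>x $ j - x' $ j\<bar>"
        using r01 a(3)[OF j] u(2)[OF j] by (intro add_mono mult_left_mono) auto
      finally show "x $ j - y $ j \<le> (1 - r) + r * \<bar>x $ j - x' $ j\<bar>" by simp
    qed
    also have "\<dots> = real n * ((1 - r) + r * d)"
      using n_pos by (simp add: d sum.distrib distrib_left flip: sum_distrib_left)
    finally have "(\<Sum>j<n. x $ j - y $ j) / real n \<le> (1 - r) + r * d"
      using n_pos by (simp add: divide_le_eq mult.commute)
    also have "\<dots> \<le> \<tau> + d"
      using r\<tau>(3) mult_right_mono[OF r01(2) d0] by simp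
    finally have "\<beta>\<^sup>2 * ((\<Sum>j<n. x $ j - y $ j) / real n) \<le> \<beta>\<^sup>2 * (\<tau> + d)"
      using b2 by (intro mult_left_mono) auto
    also have "\<dots> = 1 / r - 1" by (simp add: \<tau>_eq r\<tau>)
    also have "\<dots> \<le> (1 / r - 1) / x $ i"
      using xi r01 by (simp add: le_divide_eq mult_left_le)
    also have "\<dots> = 1 / (r * x $ i) - 1 / x $ i"
      using xi r01 by (simp add: field_simps)
    also have "\<dots> \<le> 1 / y $ i - 1 / x $ i"
      using u(1,3)[OF i] u0 xi r01 by (intro diff_right_mono divide_left_mono) auto
    finally show "\<beta>\<^sup>2 * ((\<Sum>j<n. x $ j - y $ j) / real n) \<le> 1 / y $ i - 1 / x $ i" .
  qed
  have "\<bar>potential x - potential (r \<cdot>\<^sub>v x)\<bar> \<le> 2 * Omega_bound * vnorm (x - r \<cdot>\<^sub>v x)"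
  proof (rule potential_segment[OF a(1) lx])
    fix t :: real assume t: "t \<in> {0..1}"
    have "t * (1 - r) \<le> 1 - r" "0 \<le> t * (1 - r)"
      using t r01 by (auto intro!: mult_left_le_one_le)
    then have s: "0 < 1 - t * (1 - r)" "1 - t * (1 - r) \<le> 1"
      using r01 by linarith+
    moreover have "seg x (r \<cdot>\<^sub>v x) t = (1 - t * (1 - r)) \<cdot>\<^sub>v x"
      using a(1) by (intro eq_vecI) (auto simp: seg_def algebra_simps)
    ultimately show "seg x (r \<cdot>\<^sub>v x) t \<in> admissible \<beta> A c n"
      using down by metis
  qed
  moreover have "vnorm (x - r \<cdot>\<^sub>v x) \<le> \<beta>\<^sup>2 / (1 - \<beta>\<^sup>2) * vnorm (x - x')"
  proof -
    have "x - r \<cdot>\<^sub>v x = (1 - r) \<cdot>\<^sub>v x"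
      using a(1) by (intro eq_vecI) (auto simp: algebra_simps)
    then have "vnorm (x - r \<cdot>\<^sub>v x) = (1 - r) * vnorm x"
      using r01 by (simp add: vnorm_smult)
    also have "\<dots> \<le> \<tau> * sqrt (real n)"
      using r\<tau>(3) \<tau>0 a(1-3) by (intro mult_mono vnorm_le_sqrt_dim) (auto simp: less_imp_le)
    also have "\<dots> = \<beta>\<^sup>2 / (1 - \<beta>\<^sup>2) * (d * sqrt (real n))"
      by (simp add: \<tau>_def)
    also have "\<dots> \<le> \<beta>\<^sup>2 / (1 - \<beta>\<^sup>2) * vnorm (x - x')"
    proof (rule mult_left_mono)
      have "(\<Sum>i<n. \<bar>x $ i - x' $ i\<bar>) \<le> sqrt (real n) * vnorm (x - x')"
        using abs_vec_sum_le[of "x - x'" n] a(1) a'(1) by simp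
      then have "d * sqrt (real n) \<le> sqrt (real n) * vnorm (x - x') / real n * sqrt (real n)"
        unfolding d by (intro mult_right_mono divide_right_mono) auto
      also have "\<dots> = vnorm (x - x')"
        using n_pos by (simp add: field_simps)
      finally show "d * sqrt (real n) \<le> vnorm (x - x')" .
    qed (use b2 in simp)
    finally show ?thesis .
  qed
  moreover have "\<bar>potential (r \<cdot>\<^sub>v x) - potential z\<bar> \<le> 2 * Omega_bound * vnorm (r \<cdot>\<^sub>v x - z)"
  proof (rule potential_segment[OF lx zc])
    fix t :: real assume t: "t \<in> {0..1}"
    let ?u = "\<lambda>i. (1 - t) * x $ i + t * min (x $ i) (x' $ i)"
    show "seg (r \<cdot>\<^sub>v x) z t \<in> admissible \<beta> A c n"
    proof (rule across[of _ ?u])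
      fix i assume i: "i < n"
      show "seg (r \<cdot>\<^sub>v x) z t $ i = r * ?u i"
        using i a(1) zc by (simp add: seg_index[of _ n] zi algebra_simps)
      let ?m = "min (x $ i) (x' $ i)"
      have "0 \<le> (1 - t) * (x $ i - ?m)" "0 \<le> t * (x $ i - ?m)"
        using t by (intro mult_nonneg_nonneg; simp)+
      moreover have "?u i - ?m = (1 - t) * (x $ i - ?m)" "x $ i - ?u i = t * (x $ i - ?m)"
        by (simp_all add: left_diff_distrib right_diff_distrib)
      ultimately show "?m \<le> ?u i" "?u i \<le> x $ i"
        by linarith+
    qed (simp add: seg_carrier[OF lx zc])
  qed
  moreover have "vnorm (r \<cdot>\<^sub>v x - z) \<le> vnorm (x - x')"
  proof (rule vnorm_mono[of _ n])
    fix i assume i: "i < n"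
    have "\<bar>(r \<cdot>\<^sub>v x - z) $ i\<bar> = r * \<bar>x $ i - min (x $ i) (x' $ i)\<bar>"
      using i a(1) zc r01 by (simp add: zi abs_mult flip: right_diff_distrib)
    also have "\<dots> \<le> 1 * \<bar>x $ i - x' $ i\<bar>"
      using r01 by (intro mult_mono) auto
    finally show "\<bar>(r \<cdot>\<^sub>v x - z) $ i\<bar> \<le> \<bar>(x - x') $ i\<bar>"
      using i a(1) a'(1) by simp
  qed (use lx zc a(1) a'(1) in auto)
  ultimately have "\<bar>potential x - potential z\<bar> \<le> 2 * Omega_bound * (\<beta>\<^sup>2 / (1 - \<beta>\<^sup>2) * vnorm (x - x')) + 2 * Omega_bound * vnorm (x - x')"
    using Omega_bound_nonneg mult_left_mono[of _ _ "2 * Omega_bound"] by (smt (verit, best))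
  also have "\<dots> = 2 * Omega_bound / (1 - \<beta>\<^sup>2) * vnorm (x - x')"
    using b2 by (simp add: field_simps)
  finally show ?thesis .
qed

text \<open>
  The end point of the descent from \<open>x\<close> towards \<open>x'\<close> is symmetric in the two points.
\<close>

lemma potential_lipschitz:
  assumes x: "x \<in> admissible \<beta> A c n" and x': "x' \<in> admissible \<beta> A c n"
  shows "\<bar>potential x - potential x'\<bar> \<le> 4 * Omega_bound / (1 - \<beta>\<^sup>2) * vnorm (x - x')"
proof -
  define d where "d = (\<Sum>i<n. \<bar>x $ i - x' $ i\<bar>) / real n"
  define r where "r = 1 / (1 + \<beta>\<^sup>2 * d / (1 - \<beta>\<^sup>2))"
  define z where "z = vec n (\<lambda>i. r * min (x $ i) (x' $ i))"
  have d': "d = (\<Sum>i<n. \<bar>x' $ i - x $ i\<bar>) / real n"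
    unfolding d_def by (simp add: abs_minus_commute)
  have z': "z = vec n (\<lambda>i. r * min (x' $ i) (x $ i))"
    unfolding z_def by (simp add: min.commute)
  have "\<bar>potential x - potential z\<bar> \<le> 2 * Omega_bound / (1 - \<beta>\<^sup>2) * vnorm (x - x')"
    by (rule potential_descend[OF x x' d_def r_def z_def])
  moreover have "\<bar>potential x' - potential z\<bar> \<le> 2 * Omega_bound / (1 - \<beta>\<^sup>2) * vnorm (x - x')"
    using potential_descend[OF x' x d' r_def z'] admissibleD(1)[OF x] admissibleD(1)[OF x']
    by (simp add: vnorm_minus_commute[of x' n x])
  moreover have "\<bar>potential x - potential x'\<bar> \<le> \<bar>potential x - potential z\<bar> + \<bar>potential x' - potential z\<bar>"
    using abs_triangle_ineq4[of "potential x - potential z" "potential x' - potential z"] by simp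
  moreover have "4 * Omega_bound / (1 - \<beta>\<^sup>2) * vnorm (x - x')
      = 2 * Omega_bound / (1 - \<beta>\<^sup>2) * vnorm (x - x') + 2 * Omega_bound / (1 - \<beta>\<^sup>2) * vnorm (x - x')"
    by simp
  ultimately show ?thesis
    by linarith
qed

text \<open>
  The trace of \<open>Q - R\<close>, by the resolvent identity and the symmetry of \<open>R\<close>.
\<close>

definition rank1_trace where
  "rank1_trace m = 2 * \<beta>\<^sup>2 / real n * ((Q_hat \<beta> A m *\<^sub>v m) \<bullet> (R_of \<beta> A (one_minus_sq m) *\<^sub>v m))"

lemma omega_eq:
  assumes m: "m \<in> S_dom \<beta> n A c"
  shows "omega \<beta> A m = (potential (one_minus_sq m) + rank1_trace m + real n) / 2"
proof -
  let ?x = "one_minus_sq m"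
  let ?Q = "Q_hat \<beta> A m" and ?R = "R_of \<beta> A ?x"
  note mc = open_cubeD(1)[OF S_domD(1)[OF m]]
  note x = one_minus_sq_admissible[OF m]
  note xc = admissibleD(1)[OF x]
  have "?Q * hess_TAP \<beta> A m = 1\<^sub>m n"
    using resolvent.R_left[OF resolvent_Q[OF m]] by (simp add: hess_eq(1)[OF mc] inv_diag_eq xc)
  moreover have "Y_of \<beta> A ?x * ?R = 1\<^sub>m n"
    using resolvent.R_right[OF resolvent_R[OF x]] by (simp add: Y_of_def inv_diag_eq xc)
  moreover have "Y_of \<beta> A ?x - hess_TAP \<beta> A m = rank1 \<beta> m"
    using Y_carrier[OF xc] rank1_carrier[OF mc] unfolding hess_eq(2)[OF mc]
    by (intro eq_matI) auto
  ultimately have "?Q - ?R = ?Q * rank1 \<beta> m * ?R"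
    using resolvent_identity[of ?Q n ?R "hess_TAP \<beta> A m" "Y_of \<beta> A ?x"] Q_carrier[OF m]
      R_carrier[OF x] Y_carrier[OF xc] rank1_carrier[OF mc] by (simp add: hess_eq(2)[OF mc] minus_carrier_mat)
  also have "?Q * rank1 \<beta> m * ?R = (2 * \<beta>\<^sup>2 / real n) \<cdot>\<^sub>m (?Q * outer m m * ?R)"
    unfolding rank1_def using mc Q_carrier[OF m] R_carrier[OF x]
    by (simp add: mult_smult_distrib[where nr = n and n = n and nc = n]
        mult_smult_assoc_mat[where nr = n and n = n and nc = n] square_carrier[of _ n])
  also have "?Q * outer m m * ?R = outer (?Q *\<^sub>v m) (?R *\<^sub>v m)"
    using mc Q_carrier[OF m] R_carrier[OF x] mult_mat_vec_carrier[OF Q_carrier[OF m] mc]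
    by (simp add: mult_outer[of _ n] outer_mult[of _ n] R_sym[OF x])
  finally have "mtrace (?Q - ?R) = rank1_trace m"
    using mult_mat_vec_carrier[OF Q_carrier[OF m] mc] mult_mat_vec_carrier[OF R_carrier[OF x] mc]
    by (simp add: rank1_trace_def mtrace_smult[of _ n] mtrace_outer[of _ n])
  then have "mtrace ?Q = mtrace ?R + rank1_trace m"
    using mtrace_diff[OF Q_carrier[OF m] R_carrier[OF x]] by simp
  moreover have "(vnorm m)\<^sup>2 = real n - (\<Sum>i<n. ?x $ i)"
    using mc by (simp add: vnorm_square_sum one_minus_sq_def sum_subtractf)
  ultimately show ?thesis
    by (simp add: omega_def potential_def)
qed

text \<open>
  The factor \<open>\<surd>n\<close> is the length of \<open>w\<close>. Together with the length \<open>\<surd>n/c\<close> of the other vector in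
  \<open>rank1_trace\<close> it is compensated by the factor \<open>1/n\<close> there.
\<close>

lemma resolvent_mult_vec_lipschitz:
  assumes m: "m \<in> S_dom \<beta> n A c" and w: "w \<in> S_dom \<beta> n A c"
    and X: "op_bound n (1 / c) X" and X': "X' \<in> carrier_mat n n"
    and close: "norm_F (X - X') \<le> lip_R c g l * (2 * vnorm (m - w))"
  shows "vnorm (X *\<^sub>v m - X' *\<^sub>v w) \<le> (1 / c + 2 * lip_R c g l) * sqrt (real n) * vnorm (m - w)"
proof -
  note mc = open_cubeD(1)[OF S_domD(1)[OF m]] and wc = open_cubeD(1)[OF S_domD(1)[OF w]]
  note Xc = op_boundD(2)[OF X]
  let ?d = "vnorm (m - w)" and ?r = "sqrt (real n)"
  have "vnorm (X *\<^sub>v (m - w)) \<le> 1 / c * ?d"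
    using mc wc by (intro op_boundD(3)[OF X]) simp
  also have "\<dots> \<le> ?r * (1 / c * ?d)"
    using mult_right_mono[of 1 ?r "1 / c * ?d"] n_pos c_pos by simp
  finally have 1: "vnorm (X *\<^sub>v (m - w)) \<le> ?r * (1 / c * ?d)" .
  have "vnorm ((X - X') *\<^sub>v w) \<le> norm_F (X - X') * vnorm w"
    using X' wc by (intro vnorm_mult_mat_vec_le[of _ n] minus_carrier_mat) auto
  also have "\<dots> \<le> lip_R c g l * (2 * ?d) * ?r"
    using close vnorm_cube[OF S_domD(1)[OF w]] order_trans[OF norm_F_nonneg close]
    by (intro mult_mono) auto
  finally show ?thesis
    using diff_mat_vec_le[OF Xc X' mc wc] 1 by (simp add: algebra_simps)
qed

lemma rank1_trace_lipschitz:
  assumes m: "m \<in> S_dom \<beta> n A c" and w: "w \<in> S_dom \<beta> n A c"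
  shows "\<bar>rank1_trace m - rank1_trace w\<bar> \<le> 4 * \<beta>\<^sup>2 * (1 / c + 2 * lip_R c g l) / c * vnorm (m - w)"
proof -
  let ?d = "vnorm (m - w)" and ?r = "sqrt (real n)" and ?l = "1 / c + 2 * lip_R c g l"
  let ?q = "Q_hat \<beta> A m *\<^sub>v m" and ?q' = "Q_hat \<beta> A w *\<^sub>v w"
  let ?p = "R_of \<beta> A (one_minus_sq m) *\<^sub>v m" and ?p' = "R_of \<beta> A (one_minus_sq w) *\<^sub>v w"
  note m' = S_domD(1)[OF m] and w' = S_domD(1)[OF w]
  note mc = open_cubeD(1)[OF m'] and wc = open_cubeD(1)[OF w']
  note x = one_minus_sq_admissible[OF m] and y = one_minus_sq_admissible[OF w]
  have carr: "?q \<in> carrier_vec n" "?q' \<in> carrier_vec n" "?p \<in> carrier_vec n" "?p' \<in> carrier_vec n"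
    using Q_carrier[OF m] Q_carrier[OF w] R_carrier[OF x] R_carrier[OF y] mc wc
    by (auto intro: mult_mat_vec_carrier)
  have q: "vnorm (?q - ?q') \<le> ?l * ?r * ?d"
    by (intro resolvent_mult_vec_lipschitz m w Q_bound Q_carrier
        resolvent_pair.norm_F_R_diff[OF pair_QQ])
  have p: "vnorm (?p - ?p') \<le> ?l * ?r * ?d"
    by (intro resolvent_mult_vec_lipschitz m w R_carrier x y
        resolvent.R_bound[OF resolvent_R] resolvent_pair.norm_F_R_diff[OF pair_RR] one_minus_sq_diff m' w')
  have size: "vnorm (X *\<^sub>v v) \<le> ?r / c" if X: "op_bound n (1 / c) X" and v: "v \<in> open_cube n" for X v
    using op_boundD(3)[OF X open_cubeD(1)[OF v]] mult_left_mono[OF vnorm_cube[OF v], of "1 / c"] c_pos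
    by simp
  have "?q \<bullet> ?p - ?q' \<bullet> ?p' = (?q - ?q') \<bullet> ?p + ?q' \<bullet> (?p - ?p')"
    using carr by (simp add: minus_scalar_prod_distrib[of _ n] scalar_prod_minus_distrib[of _ n])
  then have "\<bar>?q \<bullet> ?p - ?q' \<bullet> ?p'\<bar> \<le> vnorm (?q - ?q') * vnorm ?p + vnorm ?q' * vnorm (?p - ?p')"
    using abs_scalar_prod_le[of "?q - ?q'" n ?p] abs_scalar_prod_le[of ?q' n "?p - ?p'"] carr by simp
  also have "\<dots> \<le> (?l * ?r * ?d) * (?r / c) + (?r / c) * (?l * ?r * ?d)"
    using q p size[OF resolvent.R_bound[OF resolvent_R[OF x]] m'] size[OF Q_bound[OF w] w'] c_pos
      order_trans[OF vnorm_nonneg q]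
    by (intro add_mono mult_mono) auto
  also have "\<dots> = real n * (2 * ?l / c * ?d)"
  proof -
    have "(l * r * d) * (r * k) + (r * k) * (l * r * d) = (r * r) * (2 * l * k * d)" for l r d k :: real
      by (simp add: algebra_simps)
    from this[of ?l ?r ?d "1 / c"] show ?thesis by simp
  qed
  finally have "\<bar>?q \<bullet> ?p - ?q' \<bullet> ?p'\<bar> \<le> real n * (2 * ?l / c * ?d)" .
  then have "2 * \<beta>\<^sup>2 / real n * \<bar>?q \<bullet> ?p - ?q' \<bullet> ?p'\<bar> \<le> 2 * \<beta>\<^sup>2 / real n * (real n * (2 * ?l / c * ?d))"
    by (intro mult_left_mono) auto
  also have "\<dots> = 4 * \<beta>\<^sup>2 * ?l / c * ?d"
    using n_pos by simp
  also have "2 * \<beta>\<^sup>2 / real n * \<bar>?q \<bullet> ?p - ?q' \<bullet> ?p'\<bar> = \<bar>rank1_trace m - rank1_trace w\<bar>"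
    unfolding rank1_trace_def right_diff_distrib[symmetric] abs_mult by simp
  finally show ?thesis .
qed

lemma omega_lipschitz:
  assumes m: "m \<in> S_dom \<beta> n A c" and w: "w \<in> S_dom \<beta> n A c"
  shows "\<bar>omega \<beta> A m - omega \<beta> A w\<bar>
    \<le> (4 * Omega_bound / (1 - \<beta>\<^sup>2) + 2 * \<beta>\<^sup>2 * (1 / c + 2 * lip_R c g l) / c) * vnorm (m - w)"
proof -
  let ?x = "one_minus_sq m" and ?y = "one_minus_sq w"
  have "0 \<le> 4 * Omega_bound / (1 - \<beta>\<^sup>2)"
    using Omega_bound_nonneg \<beta>_pos \<beta>_less_1 by (simp add: abs_square_le_1)
  then have "4 * Omega_bound / (1 - \<beta>\<^sup>2) * vnorm (?x - ?y) \<le> 4 * Omega_bound / (1 - \<beta>\<^sup>2) * (2 * vnorm (m - w))"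
    using one_minus_sq_diff[OF S_domD(1)[OF m] S_domD(1)[OF w]] by (rule mult_left_mono[rotated])
  then have "\<bar>potential ?x - potential ?y\<bar> \<le> 4 * Omega_bound / (1 - \<beta>\<^sup>2) * (2 * vnorm (m - w))"
    using potential_lipschitz[OF one_minus_sq_admissible[OF m] one_minus_sq_admissible[OF w]] by linarith
  moreover have "omega \<beta> A m - omega \<beta> A w
      = (potential ?x - potential ?y) / 2 + (rank1_trace m - rank1_trace w) / 2"
    by (simp add: omega_eq[OF m] omega_eq[OF w] field_simps)
  then have "\<bar>omega \<beta> A m - omega \<beta> A w\<bar> \<le> \<bar>potential ?x - potential ?y\<bar> / 2 + \<bar>rank1_trace m - rank1_trace w\<bar> / 2"
    using abs_triangle_ineq[of "(potential ?x - potential ?y) / 2" "(rank1_trace m - rank1_trace w) / 2"]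
    by (simp only: abs_divide abs_numeral)
  ultimately show ?thesis
    using rank1_trace_lipschitz[OF m w] by (simp add: distrib_right)
qed

end

section \<open>The corollary\<close>

theorem corollary6p10:
  fixes C \<beta> c :: real
  assumes "C > 0" and "0 < \<beta>" and "\<beta> < 1" and "0 < c"
  shows "\<exists>(C\<^sub>\<beta>\<^sub>c :: real) (L :: real) (L_drift :: real) (L\<^sub>\<omega> :: real) (N :: nat).
    0 \<le> L \<and> L \<le> C\<^sub>\<beta>\<^sub>c \<and> 0 \<le> L_drift \<and> 0 \<le> L\<^sub>\<omega> \<and>
    (\<forall>n\<ge>N. \<forall>A\<in>carrier_mat n n.
      transpose_mat A = A \<longrightarrow> norm_op A \<le> 3 \<longrightarrow> A \<in> Omega C \<beta> c n \<longrightarrow>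
        (\<forall>m\<in>S_dom \<beta> n A c. (vnorm (f_drift \<beta> A m - m))\<^sup>2 \<le> C\<^sub>\<beta>\<^sub>c\<^sup>2) \<and>
        (\<forall>m\<in>S_dom \<beta> n A c. \<forall>w\<in>S_dom \<beta> n A c.
          norm_F (Q_hat \<beta> A m - Q_hat \<beta> A w) \<le> L * vnorm (m - w)) \<and>
        (\<forall>m\<in>S_dom \<beta> n A c. \<forall>w\<in>S_dom \<beta> n A c.
          vnorm (Q_hat \<beta> A m *\<^sub>v (m - f_drift \<beta> A m) - Q_hat \<beta> A w *\<^sub>v (w - f_drift \<beta> A w))
            \<le> L_drift * vnorm (m - w)) \<and>
        (\<forall>m\<in>S_dom \<beta> n A c. \<forall>w\<in>S_dom \<beta> n A c.
          \<bar>omega \<beta> A m - omega \<beta> A w\<bar> \<le> L\<^sub>\<omega> * vnorm (m - w)))"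
proof -
  \<comment> \<open>The constants of the estimates above, written out so that they visibly do not depend on \<open>n\<close> and \<open>A\<close>.\<close>
  define g l where "g = 3 * \<beta>\<^sup>2 + 3 * \<beta>" and "l = 3 * \<beta>\<^sup>2"
  define Omega_bound where "Omega_bound = C * \<beta> / (gamma_Y \<beta> c)\<^sup>2"
  define defect_bound_Q where "defect_bound_Q = 2 * Omega_bound + lip_defect \<beta> c g l"
  define B where "B = defect_bound_Q + 2 * \<beta>\<^sup>2 / c\<^sup>2"
  define L where "L = 2 * lip_R c g l"
  define L_drift where "L_drift = L * B
    + (defect_bound_Q + 2 * lip_defect \<beta> c g l + 2 * \<beta>\<^sup>2 * (1 / c\<^sup>2 + 4 * lip_R c g l / c)) / c"
  define L_omega where "L_omega = 4 * Omega_bound / (1 - \<beta>\<^sup>2) + 2 * \<beta>\<^sup>2 * (1 / c + 2 * lip_R c g l) / c"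
  have b2: "\<beta>\<^sup>2 < 1"
    using assms by (simp add: abs_square_less_1)
  have nonneg: "0 \<le> g" "0 \<le> l" "0 \<le> Omega_bound"
    using assms by (simp_all add: g_def l_def Omega_bound_def)
  have lip: "0 \<le> lip_R c g l"
    using nonneg assms by (simp add: lip_R_def)
  then have "0 \<le> lip_RD c g l"
    using nonneg assms by (simp add: lip_RD_def)
  then have fl: "0 \<le> lip_defect \<beta> c g l"
    using nonneg lip assms by (simp add: lip_defect_def)
  have defect_bound_Q: "0 \<le> defect_bound_Q" and B: "0 \<le> B"
    using fl nonneg assms by (simp_all add: defect_bound_Q_def B_def)
  have L: "0 \<le> L" "0 \<le> L_drift" "0 \<le> L_omega"
    using lip fl defect_bound_Q B nonneg b2 assms by (simp_all add: L_def L_drift_def L_omega_def)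
  have main: "(vnorm (f_drift \<beta> A m - m))\<^sup>2 \<le> (max L B)\<^sup>2"
      "norm_F (Q_hat \<beta> A m - Q_hat \<beta> A w) \<le> L * vnorm (m - w)"
      "vnorm (Q_hat \<beta> A m *\<^sub>v (m - f_drift \<beta> A m) - Q_hat \<beta> A w *\<^sub>v (w - f_drift \<beta> A w))
        \<le> L_drift * vnorm (m - w)"
      "\<bar>omega \<beta> A m - omega \<beta> A w\<bar> \<le> L_omega * vnorm (m - w)"
    if "1 \<le> n" "A \<in> carrier_mat n n" "transpose_mat A = A" "norm_op A \<le> 3" "A \<in> Omega C \<beta> c n"
      and m: "m \<in> S_dom \<beta> n A c" and w: "w \<in> S_dom \<beta> n A c" for n A m w
  proof -
    interpret t: tap_Omega \<beta> c n A C
      using that assms by unfold_locales auto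
    note defs = g_def l_def t.Omega_bound_def t.defect_bound_Q_def t.drift_size_def t.lip_drift_def Omega_bound_def defect_bound_Q_def B_def L_def
      L_drift_def L_omega_def
    have "vnorm (f_drift \<beta> A m - m) \<le> max L B"
      using t.drift_bound[OF m] by (simp add: defs)
    then show "(vnorm (f_drift \<beta> A m - m))\<^sup>2 \<le> (max L B)\<^sup>2"
      by (intro power_mono) auto
    show "norm_F (Q_hat \<beta> A m - Q_hat \<beta> A w) \<le> L * vnorm (m - w)"
      using t.Q_lipschitz[OF m w] by (simp add: defs)
    show "vnorm (Q_hat \<beta> A m *\<^sub>v (m - f_drift \<beta> A m) - Q_hat \<beta> A w *\<^sub>v (w - f_drift \<beta> A w))
        \<le> L_drift * vnorm (m - w)"
      using t.preconditioned_drift_lipschitz[OF m w] unfolding defs .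
    show "\<bar>omega \<beta> A m - omega \<beta> A w\<bar> \<le> L_omega * vnorm (m - w)"
      using t.omega_lipschitz[OF m w] unfolding defs .
  qed
  \<comment> \<open>The maximum yields \<open>L \<le> C\<^sub>\<beta>\<^sub>c\<close>; the threshold \<open>1\<close> makes the mean over the coordinates meaningful.\<close>
  show ?thesis
    by (rule exI[of _ "max L B"], rule exI[of _ L], rule exI[of _ L_drift], rule exI[of _ L_omega],
        rule exI[of _ 1]) (use L main in auto)
qed

end
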